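(* Let $n\ge 2$, $1\le s\le n-1$, $m>0$, $\mu>0$, and let $\mathcal{C}'$ denote the class of all subsets of $\{1,\ldots,n\}$ with cardinality $s$, $s+1$ or $s-1$. Consider any adaptive sensing strategy with total budget $m$, with resulting data $D=\{Y_i,A_i,\Gamma_i\}_{i=1}^\infty$, and let $\hat S=\hat S(D)$ be an arbitrary estimator of the support. If $$\max_{S\in\mathcal{C}'}\mathbb{E}_S\bigl[d(\hat S,S)\bigr]\le\epsilon,$$ where $0<\epsilon<1$, then necessarily the signal magnitude $x_{\min}=\mu$ satisfies $$x_{\min}\ \ge\ \sqrt{\frac{2n}{m}\left(\log s+\log\frac{n-s}{n+1}+\log\frac{1}{2\epsilon}\right)}.$$
   Context: Signal model: for $S\subseteq\{1,\ldots,n\}$ the signal $\vec{x}\in\mathbb{R}^n$ with support $S$ is given by $x_i=\mu$ if $i\in S$ and $x_i=0$ otherwise; for $S\neq\emptyset$, $x_{\min}=\min\{|x_i|:x_i\neq0\}=\mu$. Adaptive sensing: one observes $Y_k=x_{A_k}+\Gamma_k^{-1}W_k$, $k=1,2,\ldots$, where $A_k\in\{1,\ldots,n\}$ is the entry measured at time $k$ and $\Gamma_k^2$ is the precision of that measurement. The pair $(A_k,\Gamma_k)$ is chosen as a (possibly randomized) function of the past $\{Y_i,A_i,\Gamma_i\}_{i=1}^{k-1}$; the $W_k$ are standard normal, each $W_k$ being independent of $\{Y_i\}_{i=1}^{k-1}$, $\{A_i,\Gamma_i\}_{i=1}^{k}$ (and of any extra randomization). The sensing strategy is the collection of conditional distributions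 of $(A_k,\Gamma_k)$ given $\{Y_i,A_i,\Gamma_i\}_{i=1}^{k-1}$, for all $k$; it does not depend on the unknown $S$. The budget constraint is $\sum_{k=1}^\infty\Gamma_k^2\le m$ (almost surely). Convention: $\Gamma_k=0$ is allowed and means that no (informative) measurement is made at step $k$. $\mathbb{E}_S$ denotes expectation when the support is $S$. An estimator $\hat S$ is a measurable function of $D$ with values in the subsets of $\{1,\ldots,n\}$, and $d(\hat S,S)=|\hat S\,\Delta\,S|$ is the cardinality of the symmetric difference. If the quantity under the square root is negative, the lower bound is understood to be vacuous. *)

theory Defs
  imports "HOL-Probability.Probability"
begin

definition signal :: "real \<Rightarrow> nat set \<Rightarrow> nat \<Rightarrow> real" where
  "signal \<mu> S i = (if i \<in> S then \<mu> else 0)"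

definition x_min :: "nat \<Rightarrow> (nat \<Rightarrow> real) \<Rightarrow> real" where
  "x_min n x = Min {\<bar>x i\<bar> | i. i \<in> {1..n} \<and> x i \<noteq> 0}"

lemma x_min_signal:
  assumes "S \<subseteq> {1..n}" "S \<noteq> {}" "0 < \<mu>"
  shows "x_min n (signal \<mu> S) = \<mu>"
proof -
  have "{\<bar>signal \<mu> S i\<bar> | i. i \<in> {1..n} \<and> signal \<mu> S i \<noteq> 0} = {\<mu>}"
    using assms by (force simp: signal_def)
  then show ?thesis
    by (simp add: x_min_def)
qed

definition near_sparse_class :: "nat \<Rightarrow> nat \<Rightarrow> nat set set" where
  "near_sparse_class n s = {S. S \<subseteq> {1..n} \<and> card S \<in> {s, s + 1, s - 1}}"

text \<open>
  Time is indexed from \<open>0\<close>. An action is a pair \<open>(a, g)\<close> of an entry and the square root of a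
  precision; an observation is a triple \<open>(y, a, g)\<close>.
\<close>

definition action_space :: "nat \<Rightarrow> (nat \<times> real) measure" where
  "action_space n = count_space {1..n} \<Otimes>\<^sub>M borel"

definition obs_space :: "nat \<Rightarrow> (real \<times> nat \<times> real) measure" where
  "obs_space n = borel \<Otimes>\<^sub>M action_space n"

definition history_space :: "nat \<Rightarrow> nat \<Rightarrow> (nat \<Rightarrow> real \<times> nat \<times> real) measure" where
  "history_space n k = (\<Pi>\<^sub>M i\<in>{..<k}. obs_space n)"

definition data_space :: "nat \<Rightarrow> (nat \<Rightarrow> real \<times> nat \<times> real) measure" where
  "data_space n = (\<Pi>\<^sub>M i\<in>UNIV. obs_space n)"

text \<open>
  A strategy is a sequence of probability kernels: \<open>K k h\<close> is the conditional distribution of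
  the action at time \<open>k\<close> given the history \<open>h\<close> of the observations at times \<open>i < k\<close>.
\<close>

definition sensing_strategy ::
  "nat \<Rightarrow> (nat \<Rightarrow> (nat \<Rightarrow> real \<times> nat \<times> real) \<Rightarrow> (nat \<times> real) measure) \<Rightarrow> bool" where
  "sensing_strategy n K \<longleftrightarrow>
     (\<forall>k. K k \<in> history_space n k \<rightarrow>\<^sub>M prob_algebra (action_space n))"

definition history ::
  "(nat \<Rightarrow> 'w \<Rightarrow> real) \<Rightarrow> (nat \<Rightarrow> 'w \<Rightarrow> nat) \<Rightarrow> (nat \<Rightarrow> 'w \<Rightarrow> real) \<Rightarrow> nat \<Rightarrow> 'w
    \<Rightarrow> nat \<Rightarrow> real \<times> nat \<times> real" where
  "history Y A \<Gamma> k \<omega> = (\<lambda>i\<in>{..<k}. (Y i \<omega>, A i \<omega>, \<Gamma> i \<omega>))"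

definition data ::
  "(nat \<Rightarrow> 'w \<Rightarrow> real) \<Rightarrow> (nat \<Rightarrow> 'w \<Rightarrow> nat) \<Rightarrow> (nat \<Rightarrow> 'w \<Rightarrow> real) \<Rightarrow> 'w
    \<Rightarrow> nat \<Rightarrow> real \<times> nat \<times> real" where
  "data Y A \<Gamma> \<omega> = (\<lambda>i. (Y i \<omega>, A i \<omega>, \<Gamma> i \<omega>))"

text \<open>
  The experiment performed with strategy \<open>K\<close> when the unknown signal is \<open>x\<close>. At a step with
  \<open>\<Gamma> k \<omega> = 0\<close> no measurement is made; this must be treated separately, since \<open>inverse 0 = 0\<close> would
  turn such a step into a noiseless measurement, and the recorded observation is then the dummy
  value \<open>0\<close>. The budget is summed in the extended nonnegative reals, so that the constraint
  includes convergence of the series. Extra randomization used by the strategy enters only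
  through the kernels \<open>K k\<close>.
\<close>

locale adaptive_sensing = prob_space M
  for M :: "'w measure" +
  fixes n :: nat
    and m :: real
    and x :: "nat \<Rightarrow> real"
    and K :: "nat \<Rightarrow> (nat \<Rightarrow> real \<times> nat \<times> real) \<Rightarrow> (nat \<times> real) measure"
    and Y :: "nat \<Rightarrow> 'w \<Rightarrow> real"
    and A :: "nat \<Rightarrow> 'w \<Rightarrow> nat"
    and \<Gamma> :: "nat \<Rightarrow> 'w \<Rightarrow> real"
    and W :: "nat \<Rightarrow> 'w \<Rightarrow> real"
  assumes entry_measurable: "\<And>k. A k \<in> M \<rightarrow>\<^sub>M count_space {1..n}"
    and precision_measurable: "\<And>k. \<Gamma> k \<in> borel_measurable M"
    and noise_standard_normal: "\<And>k. distributed M lborel (W k) std_normal_density"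
    and noise_indep:
      "\<And>k. indep_set
              (sets (vimage_algebra (space M) (W k) borel))
              (sets (vimage_algebra (space M) (\<lambda>\<omega>. (history Y A \<Gamma> k \<omega>, (A k \<omega>, \<Gamma> k \<omega>)))
                       (history_space n k \<Otimes>\<^sub>M action_space n)))"
    and observation:
      "\<And>k \<omega>. \<omega> \<in> space M \<Longrightarrow>
         Y k \<omega> = (if \<Gamma> k \<omega> = 0 then 0 else x (A k \<omega>) + inverse (\<Gamma> k \<omega>) * W k \<omega>)"
    and strategy: "sensing_strategy n K"
    and action_cond_distribution:
      "\<And>k B. B \<in> sets (action_space n) \<Longrightarrow>
         AE \<omega> in M.
           real_cond_exp M (vimage_algebra (space M) (history Y A \<Gamma> k) (history_space n k))
             (\<lambda>\<omega>'. indicator B (A k \<omega>', \<Gamma> k \<omega>')) \<omega>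
           = measure (K k (history Y A \<Gamma> k \<omega>)) B"
    and budget: "AE \<omega> in M. (\<Sum>k. ennreal ((\<Gamma> k \<omega>)\<^sup>2)) \<le> ennreal m"

end

theory Submission
  imports Defs
begin

text \<open>
  Flipping the membership of a single entry \<open>j\<close> in the support changes the law of the data only
  through the measurements of \<open>j\<close>, so the Kullback--Leibler divergence from the law for \<open>S\<close> to the
  law for \<open>S \<triangle> {j}\<close> is \<open>\<mu>\<^sup>2 / 2\<close> times the expected precision spent on \<open>j\<close> under \<open>S\<close>. By the
  budget these divergences sum over \<open>j\<close> to at most \<open>m \<mu>\<^sup>2 / 2\<close>, that is, to \<open>n\<close> times
  \<open>c = m \<mu>\<^sup>2 / (2 n)\<close>. The Bretagnolle--Huber inequality (total error \<open>\<ge> exp (- KL) / 2\<close>),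
  linearised at \<open>c\<close> so that only the sum of the divergences matters, bounds the sum over \<open>j\<close> of the
  errors at \<open>j\<close> under \<open>S\<close> and under \<open>S \<triangle> {j}\<close> from below by \<open>n exp (- c) / 2\<close>. Summing over all
  \<open>S\<close> of size \<open>s\<close> bounds the same quantity from above by the risk at the sizes \<open>s\<close>, \<open>s + 1\<close> and
  \<open>s - 1\<close>.
\<close>

section \<open>Measure-theoretic preliminaries\<close>

text \<open>The hypothesis \<open>cond\<close> gives one null set for each event \<open>C\<close>.
  Integrated over events of \<open>X\<close>, it determines the joint law of \<open>X\<close> and
  \<open>Z\<close> on rectangles, hence everywhere, and so yields a disintegration for all
  nonnegative integrands.\<close>

lemma (in prob_space) nn_integral_regular_conditional_distribution:
  assumes X[measurable]: "X \<in> M \<rightarrow>\<^sub>M H" and Z[measurable]: "Z \<in> M \<rightarrow>\<^sub>M T"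
    and \<kappa>: "\<kappa> \<in> H \<rightarrow>\<^sub>M prob_algebra T"
    and cond: "\<And>C. C \<in> sets T \<Longrightarrow> AE \<omega> in M.
        real_cond_exp M (vimage_algebra (space M) X H) (\<lambda>\<omega>'. indicator C (Z \<omega>')) \<omega>
          = measure (\<kappa> (X \<omega>)) C"
    and f[measurable]: "f \<in> borel_measurable (H \<Otimes>\<^sub>M T)"
  shows "(\<integral>\<^sup>+\<omega>. f (X \<omega>, Z \<omega>) \<partial>M) = (\<integral>\<^sup>+\<omega>. \<integral>\<^sup>+z. f (X \<omega>, z) \<partial>\<kappa> (X \<omega>) \<partial>M)"
proof -
  let ?F = "vimage_algebra (space M) X H"
  have sub: "subalgebra M ?F"
    unfolding subalgebra_def using X
    by (auto simp: sets_vimage_algebra2[of X "space M" H] measurable_space[OF X] Pi_iff)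
  interpret finite_measure_subalgebra M ?F
    by unfold_locales (rule sub)
  have \<kappa>'[measurable]: "\<kappa> \<in> H \<rightarrow>\<^sub>M subprob_algebra T"
    using \<kappa> by (rule measurable_prob_algebraD)
  have \<kappa>X: "prob_space (\<kappa> (X \<omega>))" "sets (\<kappa> (X \<omega>)) = sets T" "space (\<kappa> (X \<omega>)) = space T"
    if "\<omega> \<in> space M" for \<omega>
  proof -
    have "\<kappa> (X \<omega>) \<in> space (prob_algebra T)"
      using measurable_space[OF \<kappa> measurable_space[OF X that]] .
    then show "prob_space (\<kappa> (X \<omega>))" "sets (\<kappa> (X \<omega>)) = sets T" "space (\<kappa> (X \<omega>)) = space T"
      by (auto simp: space_prob_algebra dest: sets_eq_imp_space_eq)
  qed
  \<comment> \<open>Carrying \<open>X \<omega>\<close> along with the draw from the kernel makes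
    \<open>M \<bind> ?k\<close> the candidate for the joint law.\<close>
  let ?k = "\<lambda>\<omega>. distr (\<kappa> (X \<omega>)) (H \<Otimes>\<^sub>M T) (Pair (X \<omega>))"
  have k: "?k \<in> M \<rightarrow>\<^sub>M subprob_algebra (H \<Otimes>\<^sub>M T)"
    by (rule measurable_distr2[where M = T]) (auto simp: case_prod_beta')
  have pair[measurable]: "Pair (X \<omega>) \<in> \<kappa> (X \<omega>) \<rightarrow>\<^sub>M H \<Otimes>\<^sub>M T" if "\<omega> \<in> space M" for \<omega>
  proof -
    have "Pair (X \<omega>) \<in> T \<rightarrow>\<^sub>M H \<Otimes>\<^sub>M T"
      using measurable_space[OF X that] by simp
    then show ?thesis
      by (simp cong: measurable_cong_sets add: \<kappa>X(2)[OF that])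
  qed
  have eq: "distr M (H \<Otimes>\<^sub>M T) (\<lambda>\<omega>. (X \<omega>, Z \<omega>)) = M \<bind> ?k"
  proof (rule measure_eqI_generator_eq[OF Int_stable_pair_measure_generator[of H T]
        pair_measure_closed, where A = "\<lambda>_. space H \<times> space T"])
    show "sets (M \<bind> ?k) = sigma_sets (space H \<times> space T) {a \<times> b |a b. a \<in> sets H \<and> b \<in> sets T}"
      by (subst sets_bind[where N = "H \<Otimes>\<^sub>M T"]) (auto simp: sets_pair_measure not_empty)
  next
    fix R assume "R \<in> {a \<times> b |a b. a \<in> sets H \<and> b \<in> sets T}"
    then obtain B C where R: "R = B \<times> C" and B[measurable]: "B \<in> sets H" and C[measurable]: "C \<in> sets T"
      by auto
    let ?XB = "X -` B \<inter> space M"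
    have XB: "?XB \<in> sets ?F"
      using B measurable_space[OF X] by (auto simp: sets_vimage_algebra2[of X "space M" H] Pi_iff)
    have XB'[measurable]: "?XB \<in> sets M" by simp
    have int: "integrable M (\<lambda>\<omega>. indicat_real C (Z \<omega>) :: real)"
      by (rule integrable_const_bound[of _ 1]) (auto simp: indicator_def)
    have me[measurable]: "(\<lambda>\<omega>. measure (\<kappa> (X \<omega>)) C) \<in> borel_measurable M"
      by (intro measurable_compose[OF X] measurable_compose[OF \<kappa>] measurable_measure_prob_algebra C)
    have "emeasure (distr M (H \<Otimes>\<^sub>M T) (\<lambda>\<omega>. (X \<omega>, Z \<omega>))) R
        = emeasure M {\<omega> \<in> space M. X \<omega> \<in> B \<and> Z \<omega> \<in> C}"
      unfolding R by (subst emeasure_distr) (auto intro!: arg_cong[where f = "emeasure M"])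
    also have "\<dots> = ennreal (\<integral>\<omega>\<in>?XB. indicat_real C (Z \<omega>) \<partial>M)"
    proof -
      have "(\<integral>\<omega>\<in>?XB. indicat_real C (Z \<omega>) \<partial>M)
          = (\<integral>\<omega>. indicat_real {\<omega> \<in> space M. X \<omega> \<in> B \<and> Z \<omega> \<in> C} \<omega> \<partial>M)"
        unfolding set_lebesgue_integral_def
        by (intro Bochner_Integration.integral_cong) (auto simp: indicator_def)
      then show ?thesis by (simp only: integral_indicator emeasure_eq_measure) (simp add: Int_absorb2)
    qed
    \<comment> \<open>\<open>?XB\<close> belongs to the sigma-algebra generated by \<open>X\<close>,
      so the indicator may be replaced by its conditional expectation.\<close>
    also have "(\<integral>\<omega>\<in>?XB. indicat_real C (Z \<omega>) \<partial>M)
        = (\<integral>\<omega>\<in>?XB. real_cond_exp M ?F (\<lambda>\<omega>'. indicat_real C (Z \<omega>')) \<omega> \<partial>M)"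
      by (rule real_cond_exp_intA[OF int XB])
    also have "\<dots> = (\<integral>\<omega>\<in>?XB. measure (\<kappa> (X \<omega>)) C \<partial>M)"
      unfolding set_lebesgue_integral_def using cond[OF C]
      by (intro integral_cong_AE) auto
    also have "ennreal \<dots> = (\<integral>\<^sup>+\<omega>. ennreal (indicator ?XB \<omega> * measure (\<kappa> (X \<omega>)) C) \<partial>M)"
      unfolding set_lebesgue_integral_def real_scaleR_def
    proof (rule nn_integral_eq_integral[symmetric])
      show "integrable M (\<lambda>\<omega>. indicator ?XB \<omega> * measure (\<kappa> (X \<omega>)) C)"
        by (rule integrable_const_bound[of _ 1])
          (auto simp: indicator_def intro!: AE_I2 prob_space.prob_le_1 \<kappa>X)
    qed auto
    also have "\<dots> = (\<integral>\<^sup>+\<omega>. emeasure (?k \<omega>) R \<partial>M)"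
    proof (rule nn_integral_cong)
      fix \<omega> assume \<omega>: "\<omega> \<in> space M"
      interpret K: prob_space "\<kappa> (X \<omega>)" by (rule \<kappa>X(1)[OF \<omega>])
      have "Pair (X \<omega>) -` (B \<times> C) \<inter> space (\<kappa> (X \<omega>)) = (if X \<omega> \<in> B then C else {})"
        using sets.sets_into_space[OF C] \<kappa>X(3)[OF \<omega>] by auto
      then show "ennreal (indicator ?XB \<omega> * measure (\<kappa> (X \<omega>)) C) = emeasure (?k \<omega>) R"
        unfolding R using \<omega> by (subst emeasure_distr) (auto simp: K.emeasure_eq_measure pair)
    qed
    also have "\<dots> = emeasure (M \<bind> ?k) R"
      unfolding R by (subst emeasure_bind[OF not_empty k]) auto
    finally show "emeasure (distr M (H \<Otimes>\<^sub>M T) (\<lambda>\<omega>. (X \<omega>, Z \<omega>))) R = emeasure (M \<bind> ?k) R" .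
  next
    show "emeasure (distr M (H \<Otimes>\<^sub>M T) (\<lambda>\<omega>. (X \<omega>, Z \<omega>))) (space H \<times> space T) \<noteq> \<infinity>"
      by (subst emeasure_distr) (auto simp: emeasure_eq_measure)
  qed (auto simp: sets_pair_measure)
  have "(\<integral>\<^sup>+\<omega>. f (X \<omega>, Z \<omega>) \<partial>M) = (\<integral>\<^sup>+p. f p \<partial>(M \<bind> ?k))"
    unfolding eq[symmetric] by (subst nn_integral_distr) auto
  also have "\<dots> = (\<integral>\<^sup>+\<omega>. \<integral>\<^sup>+p. f p \<partial>?k \<omega> \<partial>M)"
    by (rule nn_integral_bind[OF f k])
  also have "\<dots> = (\<integral>\<^sup>+\<omega>. \<integral>\<^sup>+z. f (X \<omega>, z) \<partial>\<kappa> (X \<omega>) \<partial>M)"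
    by (intro nn_integral_cong nn_integral_distr pair) auto
  finally show ?thesis .
qed

text \<open>Independence on rectangles identifies the joint law with the product of the marginals;
  Tonelli then allows \<open>Z\<close> to be integrated first.\<close>

lemma (in prob_space) nn_integral_indep_set:
  assumes X[measurable]: "X \<in> M \<rightarrow>\<^sub>M S" and Z[measurable]: "Z \<in> M \<rightarrow>\<^sub>M T"
    and indep: "indep_set (sets (vimage_algebra (space M) Z T)) (sets (vimage_algebra (space M) X S))"
    and f[measurable]: "f \<in> borel_measurable (S \<Otimes>\<^sub>M T)"
  shows "(\<integral>\<^sup>+\<omega>. f (X \<omega>, Z \<omega>) \<partial>M) = (\<integral>\<^sup>+\<omega>. \<integral>\<^sup>+z. f (X \<omega>, z) \<partial>distr M T Z \<partial>M)"
proof -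
  interpret PX: prob_space "distr M S X" by (rule prob_space_distr) simp
  interpret PZ: prob_space "distr M T Z" by (rule prob_space_distr) simp
  have eq: "distr M S X \<Otimes>\<^sub>M distr M T Z = distr M (S \<Otimes>\<^sub>M T) (\<lambda>\<omega>. (X \<omega>, Z \<omega>))"
  proof (rule pair_measure_eqI)
    fix B C assume "B \<in> sets (distr M S X)" "C \<in> sets (distr M T Z)"
    then have [measurable]: "B \<in> sets S" "C \<in> sets T" by auto
    have "X -` B \<inter> space M \<in> sets (vimage_algebra (space M) X S)"
      "Z -` C \<inter> space M \<in> sets (vimage_algebra (space M) Z T)"
      by (auto intro: in_vimage_algebra)
    with indep have "prob ((Z -` C \<inter> space M) \<inter> (X -` B \<inter> space M))
        = prob (Z -` C \<inter> space M) * prob (X -` B \<inter> space M)"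
      unfolding indep_sets2_eq by blast
    moreover have "(\<lambda>\<omega>. (X \<omega>, Z \<omega>)) -` (B \<times> C) \<inter> space M = (Z -` C \<inter> space M) \<inter> (X -` B \<inter> space M)"
      by auto
    ultimately show "emeasure (distr M S X) B * emeasure (distr M T Z) C
        = emeasure (distr M (S \<Otimes>\<^sub>M T) (\<lambda>\<omega>. (X \<omega>, Z \<omega>))) (B \<times> C)"
      by (simp add: emeasure_distr emeasure_eq_measure ennreal_mult[symmetric] mult.commute)
  qed (auto intro: PX.sigma_finite_measure_axioms PZ.sigma_finite_measure_axioms)
  have "(\<integral>\<^sup>+\<omega>. f (X \<omega>, Z \<omega>) \<partial>M) = (\<integral>\<^sup>+p. f p \<partial>(distr M S X \<Otimes>\<^sub>M distr M T Z))"
    unfolding eq by (subst nn_integral_distr) auto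
  also have "\<dots> = (\<integral>\<^sup>+h. \<integral>\<^sup>+z. f (h, z) \<partial>distr M T Z \<partial>distr M S X)"
    by (rule PZ.nn_integral_fst[symmetric]) simp
  also have "\<dots> = (\<integral>\<^sup>+\<omega>. \<integral>\<^sup>+z. f (X \<omega>, z) \<partial>distr M T Z \<partial>M)"
    by (rule nn_integral_distr) auto
  finally show ?thesis .
qed

text \<open>Separates the two errors made when a countable union is replaced by finitely many
  approximating sets: cutting off the tail, and replacing each remaining set.\<close>

lemma sym_diff_UN_subset:
  "sym_diff (\<Union>i. E i) (\<Union>i<r. C i) \<subseteq> ((\<Union>i. E i) - (\<Union>i<r. E i)) \<union> (\<Union>i<r. sym_diff (E i) (C i))"
  for r :: nat
  by blast

text \<open>The events approximable by cylinders form a sigma-algebra that contains the coordinate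
  events. A single cylinder has to serve \<open>P\<close> and \<open>Q\<close> at once, because a
  test is compared under both laws; hence the sum of the two measures.\<close>

lemma PiM_cylinder_approximation:
  fixes E :: "(nat \<Rightarrow> 'a) set" and \<eta> :: real
  assumes "finite_measure P" "finite_measure Q"
    and sP: "sets P = sets (\<Pi>\<^sub>M i\<in>UNIV. N)" and sQ: "sets Q = sets (\<Pi>\<^sub>M i\<in>UNIV. N)"
    and E: "E \<in> sets (\<Pi>\<^sub>M i\<in>UNIV. N)" and \<eta>: "0 < \<eta>"
  obtains k B where "B \<in> sets (\<Pi>\<^sub>M i\<in>{..<k}. N)"
    and "measure P (sym_diff E (prod_emb UNIV (\<lambda>_. N) {..<k} B))
       + measure Q (sym_diff E (prod_emb UNIV (\<lambda>_. N) {..<k} B)) < \<eta>"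
proof -
  let ?PI = "\<lambda>I. Pi\<^sub>M I (\<lambda>_::nat. N)"
  let ?e = "\<lambda>k. prod_emb UNIV (\<lambda>_::nat. N) {..<k}"
  interpret P: finite_measure P by fact
  interpret Q: finite_measure Q by fact
  have spP: "space P = space (?PI UNIV)" and spQ: "space Q = space (?PI UNIV)"
    using sP sQ by (auto dest: sets_eq_imp_space_eq)
  let ?\<nu> = "\<lambda>X. measure P X + measure Q X"
  have emb[measurable]: "?e k B \<in> sets (?PI UNIV)" if "B \<in> sets (?PI {..<k})" for k B
    using that by (intro measurable_prod_emb) auto
  \<comment> \<open>A cylinder over \<open>k\<close> coordinates is also one over any larger number,
    so finitely many cylinders can be given a common horizon.\<close>
  have emb_mono: "\<exists>B'\<in>sets (?PI {..<l}). ?e k B = ?e l B'" if "B \<in> sets (?PI {..<k})" "k \<le> l" for k l B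
  proof
    show "prod_emb {..<l} (\<lambda>_. N) {..<k} B \<in> sets (?PI {..<l})"
      using that by (intro measurable_prod_emb) auto
    show "?e k B = ?e l (prod_emb {..<l} (\<lambda>_. N) {..<k} B)"
      using that by (subst prod_emb_trans) auto
  qed
  have "E \<in> sigma_sets (\<Pi>\<^sub>E i\<in>UNIV. space N)
      {{f\<in>\<Pi>\<^sub>E i\<in>UNIV. space N. f i \<in> A} | i A. i \<in> (UNIV::nat set) \<and> A \<in> sets N}"
    using E by (simp add: sets_PiM_single)
  \<comment> \<open>The induction claim includes measurability, which the measure estimates use, and
    every tolerance, since the case of a union calls for smaller ones.\<close>
  then have "E \<in> sets (?PI UNIV) \<and> (\<forall>\<eta>>0. \<exists>k. \<exists>B\<in>sets (?PI {..<k}). ?\<nu> (sym_diff E (?e k B)) < \<eta>)"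
  proof induction
    case (Basic E)
    then obtain i A where E: "E = {f\<in>\<Pi>\<^sub>E i\<in>UNIV. space N. f i \<in> A}" and A[measurable]: "A \<in> sets N"
      by auto
    \<comment> \<open>Coordinate \<open>i\<close> is among the first \<open>Suc i\<close> ones, so
      the event is itself a cylinder and the error is zero.\<close>
    let ?B = "{f \<in> space (?PI {..<Suc i}). f i \<in> A}"
    have B: "?B \<in> sets (?PI {..<Suc i})" by measurable
    have "E = ?e (Suc i) ?B"
      unfolding E by (auto simp: prod_emb_def space_PiM PiE_iff)
    moreover have "?\<nu> (sym_diff (?e (Suc i) ?B) (?e (Suc i) ?B)) = 0" by simp
    ultimately show ?case using B emb[OF B] by (intro conjI allI impI exI[of _ "Suc i"] bexI[of _ ?B]) auto
  next
    case Empty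
    have "prod_emb UNIV (\<lambda>_. N) {..<0} {} = ({} :: (nat \<Rightarrow> 'a) set)" by (simp add: prod_emb_def)
    then have "?\<nu> (sym_diff {} (?e 0 {})) = 0" by simp
    then show ?case by (intro conjI allI impI exI[of _ 0] bexI[of _ "{}"]) auto
  next
    case (Compl E)
    have "\<exists>k. \<exists>B\<in>sets (?PI {..<k}). ?\<nu> (sym_diff ((\<Pi>\<^sub>E i\<in>UNIV. space N) - E) (?e k B)) < \<eta>"
      if \<eta>: "\<eta> > 0" for \<eta>
    proof -
      obtain k B where B: "B \<in> sets (?PI {..<k})" "?\<nu> (sym_diff E (?e k B)) < \<eta>"
        using Compl.IH \<eta> by blast
      have "E \<subseteq> (\<Pi>\<^sub>E i\<in>UNIV. space N)" "?e k B \<subseteq> (\<Pi>\<^sub>E i\<in>UNIV. space N)"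
        using Compl.IH sets.sets_into_space[of E "?PI UNIV"] by (auto simp: space_PiM prod_emb_def)
      moreover have "?e k (space (?PI {..<k}) - B) = (\<Pi>\<^sub>E i\<in>UNIV. space N) - ?e k B"
        by (auto simp: prod_emb_def space_PiM PiE_iff)
      \<comment> \<open>Complementing both sets leaves their symmetric difference unchanged.\<close>
      ultimately have "sym_diff ((\<Pi>\<^sub>E i\<in>UNIV. space N) - E) (?e k (space (?PI {..<k}) - B)) = sym_diff E (?e k B)"
        by blast
      with B show ?thesis by (metis sets.compl_sets)
    qed
    moreover have "(\<Pi>\<^sub>E i\<in>UNIV. space N) - E \<in> sets (?PI UNIV)"
      using Compl.IH sets.compl_sets[of E "?PI UNIV"] by (auto simp: space_PiM)
    ultimately show ?case by blast
  next
    case (Union E)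
    then have Em[measurable]: "E i \<in> sets (?PI UNIV)" for i by blast
    have "\<exists>k. \<exists>B\<in>sets (?PI {..<k}). ?\<nu> (sym_diff (\<Union>i. E i) (?e k B)) < \<eta>"
      if \<eta>: "\<eta> > 0" for \<eta>
    proof -
      have inc: "incseq (\<lambda>r. \<Union>i<r. E i)"
        by (intro monoI UN_mono) auto
      have "(\<lambda>r. ?\<nu> (\<Union>i<r. E i)) \<longlonglongrightarrow> ?\<nu> (\<Union>r. \<Union>i<r. E i)"
        by (intro tendsto_add P.finite_Lim_measure_incseq Q.finite_Lim_measure_incseq inc)
          (auto simp: sP sQ)
      also have "(\<Union>r. \<Union>i<r. E i) = (\<Union>i. E i)" by auto
      \<comment> \<open>Continuity from below: half of the tolerance pays for cutting the union at a
        finite \<open>r\<close>.\<close>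
      finally have "\<forall>\<^sub>F r in sequentially. dist (?\<nu> (\<Union>i<r. E i)) (?\<nu> (\<Union>i. E i)) < \<eta> / 2"
        using \<eta> by (intro tendstoD) auto
      then obtain r where r: "dist (?\<nu> (\<Union>i<r. E i)) (?\<nu> (\<Union>i. E i)) < \<eta> / 2"
        by (auto simp: eventually_sequentially)
      have r1: "?\<nu> ((\<Union>i. E i) - (\<Union>i<r. E i)) < \<eta> / 2"
      proof -
        have "measure P ((\<Union>i. E i) - (\<Union>i<r. E i)) = measure P (\<Union>i. E i) - measure P (\<Union>i<r. E i)"
          by (rule P.finite_measure_Diff) (auto simp: sP)
        moreover have "measure Q ((\<Union>i. E i) - (\<Union>i<r. E i)) = measure Q (\<Union>i. E i) - measure Q (\<Union>i<r. E i)"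
          by (rule Q.finite_measure_Diff) (auto simp: sQ)
        ultimately show ?thesis using r unfolding dist_real_def by linarith
      qed
      \<comment> \<open>The other half is shared among \<open>r\<close> approximations; the added
        one keeps the quotient meaningful for \<open>r = 0\<close>.\<close>
      define \<delta> where "\<delta> = \<eta> / (2 * (real r + 1))"
      have "\<delta> > 0" using \<eta> by (simp add: \<delta>_def)
      then have "\<forall>i. \<exists>k. \<exists>B\<in>sets (?PI {..<k}). ?\<nu> (sym_diff (E i) (?e k B)) < \<delta>"
        using Union by blast
      then obtain k B where kB: "\<And>i. B i \<in> sets (?PI {..<k i})" "\<And>i. ?\<nu> (sym_diff (E i) (?e (k i) (B i))) < \<delta>"
        by metis
      \<comment> \<open>The extra \<open>0\<close> keeps the set nonempty when
        \<open>r = 0\<close>.\<close>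
      define l where "l = Max (k ` {..<r} \<union> {0})"
      have "k i \<le> l" if "i < r" for i using that unfolding l_def by (intro Max_ge) auto
      then have "\<forall>i\<in>{..<r}. \<exists>B'\<in>sets (?PI {..<l}). ?e (k i) (B i) = ?e l B'"
        using emb_mono kB(1) by (metis lessThan_iff)
      then obtain B' where B': "\<And>i. i < r \<Longrightarrow> B' i \<in> sets (?PI {..<l})"
        "\<And>i. i < r \<Longrightarrow> ?e (k i) (B i) = ?e l (B' i)" by (metis lessThan_iff)
      have U: "?e l (\<Union>i<r. B' i) = (\<Union>i<r. ?e l (B' i))" by (auto simp: prod_emb_def)
      have [measurable]: "?e l (B' i) \<in> sets (?PI UNIV)" if "i < r" for i using B' that by auto
      have bd: "measure R (sym_diff (\<Union>i. E i) (\<Union>i<r. ?e l (B' i)))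
          \<le> measure R ((\<Union>i. E i) - (\<Union>i<r. E i)) + (\<Sum>i<r. measure R (sym_diff (E i) (?e l (B' i))))"
        if "finite_measure R" and sR: "sets R = sets (?PI UNIV)" for R
      proof -
        interpret R: finite_measure R by fact
        have "measure R (sym_diff (\<Union>i. E i) (\<Union>i<r. ?e l (B' i)))
            \<le> measure R (((\<Union>i. E i) - (\<Union>i<r. E i)) \<union> (\<Union>i<r. sym_diff (E i) (?e l (B' i))))"
          by (intro R.finite_measure_mono sym_diff_UN_subset) (auto simp: sR)
        also have "\<dots> \<le> measure R ((\<Union>i. E i) - (\<Union>i<r. E i)) + measure R (\<Union>i<r. sym_diff (E i) (?e l (B' i)))"
          by (intro measure_Un_le) (auto simp: sR)
        also have "measure R (\<Union>i<r. sym_diff (E i) (?e l (B' i))) \<le> (\<Sum>i<r. measure R (sym_diff (E i) (?e l (B' i))))"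
          by (intro R.finite_measure_subadditive_finite) (auto simp: sR)
        finally show ?thesis by simp
      qed
      have "?\<nu> (sym_diff (\<Union>i. E i) (?e l (\<Union>i<r. B' i)))
          \<le> ?\<nu> ((\<Union>i. E i) - (\<Union>i<r. E i)) + (\<Sum>i<r. ?\<nu> (sym_diff (E i) (?e l (B' i))))"
        unfolding U using bd[OF \<open>finite_measure P\<close> sP] bd[OF \<open>finite_measure Q\<close> sQ] by (simp add: sum.distrib)
      also have "(\<Sum>i<r. ?\<nu> (sym_diff (E i) (?e l (B' i)))) \<le> (\<Sum>i<r. \<delta>)"
        using kB(2) B'(2) by (intro sum_mono) (metis less_imp_le lessThan_iff)
      also have "(\<Sum>i<r. \<delta>) \<le> \<eta> / 2"
        using \<eta> by (simp add: \<delta>_def field_simps)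
      finally have "?\<nu> (sym_diff (\<Union>i. E i) (?e l (\<Union>i<r. B' i))) < \<eta>" using r1 by simp
      moreover have "(\<Union>i<r. B' i) \<in> sets (?PI {..<l})" using B' by auto
      ultimately show ?thesis by blast
    qed
    then show ?case by auto
  qed
  then show ?thesis using \<eta> that by blast
qed

section \<open>Real inequalities\<close>

text \<open>
  The tangent to \<open>exp (- KL) / 2\<close> at \<open>KL = c\<close>: integrating over a likelihood ratio \<open>L\<close> of mean \<open>1\<close>
  with \<open>E[ln L] = - KL\<close> gives \<open>E[min 1 L] \<ge> exp (- c) (1 / 2 + c / 2 - KL / 2)\<close>.
\<close>

lemma min_one_ge_affine:
  fixes c L :: real
  assumes "0 < L"
  shows "exp (- c) * (1 + c / 2 + ln L / 2 - (1 + L) / 4) \<le> min 1 L"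
proof -
  \<comment> \<open>In terms of \<open>u\<close> the logarithmic part is \<open>1 + ln u\<close>,
    which is at most \<open>u\<close>; what remains is polynomial in \<open>e\<close> and
    \<open>u\<close>.\<close>
  define u where "u = exp (c / 2) * sqrt L"
  define e where "e = exp (- c)"
  have e: "e > 0" by (simp add: e_def)
  have L: "L = e * u\<^sup>2"
    using assms by (simp add: u_def e_def power_mult_distrib exp_double[symmetric] exp_minus)
  have u: "u > 0" using assms by (simp add: u_def)
  have "1 + c / 2 + ln L / 2 = 1 + ln u"
    using assms by (simp add: u_def ln_mult ln_sqrt)
  also have "\<dots> \<le> u" using ln_le_minus_one[OF u] by simp
  finally have "e * (1 + c / 2 + ln L / 2 - (1 + L) / 4) \<le> e * (u - (1 + L) / 4)"
    using e by (intro mult_left_mono) auto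
  also have "\<dots> \<le> min 1 L"
  proof -
    \<comment> \<open>The first square gives the bound by \<open>1\<close>, the second the bound by
      \<open>L\<close>, after \<open>e * u\<^sup>2\<close> is replaced by \<open>L\<close>.\<close>
    have "0 \<le> (e * u - 2)\<^sup>2" "0 \<le> (2 * u - 1)\<^sup>2 * e" using e by auto
    then have "4 * e * u \<le> 4 + e * L" "4 * e * u \<le> 4 * L + e"
      unfolding L by (auto simp: power2_eq_square algebra_simps)
    moreover have "0 < e * L" using e assms by simp
    ultimately have "4 * e * u - e - e * L \<le> 4" "4 * e * u - e - e * L \<le> 4 * L"
      using e by linarith+
    moreover have "e * (u - (1 + L) / 4) = (4 * e * u - e - e * L) / 4"
      by (simp add: field_simps)
    ultimately have "e * (u - (1 + L) / 4) \<le> 1" "e * (u - (1 + L) / 4) \<le> L" by simp_all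
    then show ?thesis by simp
  qed
  finally show ?thesis by (simp add: e_def)
qed

text \<open>With \<open>a = s\<close> and \<open>b = n - s\<close>, division by
  \<open>n choose s\<close> turns the right side of the hypothesis into
  \<open>(1 + b / (a + 1) + a / (b + 1)) * \<epsilon>\<close>. The bracket times
  \<open>a * b\<close> is at most \<open>n * (n + 1)\<close>, which produces the factor
  \<open>s * (n - s) / (n + 1)\<close> of the final bound.\<close>

lemma swap_sum_sparse_bound:
  fixes n s :: nat and \<epsilon> q :: real
  assumes "1 \<le> s" "s \<le> n - 1" "0 < \<epsilon>"
    and le: "real (n choose s) * (real n / 2 * q)
        \<le> (real (n choose s) + real (n choose (s + 1)) + real (n choose (s - 1))) * \<epsilon>"
  shows "q * real s * (real n - real s) \<le> 2 * \<epsilon> * (real n + 1)"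
proof -
  define a b N where "a = real s" and "b = real n - real s" and "N = real (n choose s)"
  have s: "s < n" "1 \<le> s" using assms by auto
  have a: "a \<ge> 1" and b: "b \<ge> 1" and N: "N > 0" and n: "real n = a + b"
    using s by (auto simp: a_def b_def N_def)
  \<comment> \<open>Ratios of neighbouring binomial coefficients, written without division here and
    in the next fact.\<close>
  have 1: "real (n choose (s + 1)) * (a + 1) = N * b"
  proof -
    have "(n choose (s+1)) * (s + 1) = (n choose s) * (n - s)"
      using binomial_absorb_comp[of n s] binomial_absorption[of s n] s by (simp add: mult.commute)
    then have "real ((n choose (s+1)) * (s + 1)) = real ((n choose s) * (n - s))" by simp
    then show ?thesis using s by (simp add: a_def b_def N_def of_nat_diff algebra_simps)
  qed
  have 2: "real (n choose (s - 1)) * (b + 1) = N * a"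
  proof -
    have "(n choose (s-1)) * (n - s + 1) = (n choose s) * s"
      using binomial_absorb_comp[of n "s - 1"] binomial_absorption[of "s - 1" n] s 
      by (simp add: mult.commute Suc_diff_le)
    then have "real (n choose (s-1)) * real (n - s + 1) = real (n choose s) * real s"
      by (simp only: of_nat_mult[symmetric])
    then show ?thesis using s by (simp add: a_def b_def N_def of_nat_diff add_ac)
  qed
  have "N * (a + b) * q * ((a + 1) * (b + 1)) = 2 * (N * (real n / 2 * q)) * ((a + 1) * (b + 1))"
    by (simp add: n)
  also have "\<dots> \<le> 2 * ((N + real (n choose (s + 1)) + real (n choose (s - 1))) * \<epsilon>) * ((a + 1) * (b + 1))"
    using le a b by (intro mult_right_mono mult_left_mono) (auto simp: N_def)
  also have "\<dots> = 2 * \<epsilon> * (N * ((a + 1) * (b + 1)) + (real (n choose (s + 1)) * (a + 1)) * (b + 1)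
      + (real (n choose (s - 1)) * (b + 1)) * (a + 1))"
    by (simp add: algebra_simps)
  also have "\<dots> = N * (2 * \<epsilon> * ((a + 1) * (b + 1) + b * (b + 1) + a * (a + 1)))"
    unfolding 1 2 by (simp add: algebra_simps)
  finally have *: "(a + b) * q * ((a + 1) * (b + 1)) \<le> 2 * \<epsilon> * ((a + 1) * (b + 1) + b * (b + 1) + a * (a + 1))"
    using N by (simp add: mult.assoc)
  have poly: "((a + 1) * (b + 1) + b * (b + 1) + a * (a + 1)) * (a * b)
      \<le> (a + b + 1) * (a + b) * ((a + 1) * (b + 1))"
  proof -
    define p where "p = a * b"
    \<comment> \<open>In terms of \<open>p\<close> and \<open>k = a + b\<close> the claim is \<open>((k + 1)\<^sup>2 - p) p \<le> k (k + 1) (p + k + 1)\<close>; complete the square in \<open>p\<close>.\<close>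
    have "0 \<le> (2 * p - (a + b + 1))\<^sup>2 + (a + b + 1)\<^sup>2 * (4 * (a + b) - 1)"
      using a b by (intro add_nonneg_nonneg mult_nonneg_nonneg) auto
    then show ?thesis unfolding p_def by (simp add: power2_eq_square algebra_simps)
  qed
  have pos: "(a + b) * ((a + 1) * (b + 1)) > 0" using a b by simp
  have "(q * (a * b)) * ((a + b) * ((a + 1) * (b + 1)))
      = (a + b) * q * ((a + 1) * (b + 1)) * (a * b)" by (simp add: algebra_simps)
  also have "\<dots> \<le> 2 * \<epsilon> * ((a + 1) * (b + 1) + b * (b + 1) + a * (a + 1)) * (a * b)"
    using * a b by (intro mult_right_mono) auto
  also have "\<dots> = 2 * \<epsilon> * (((a + 1) * (b + 1) + b * (b + 1) + a * (a + 1)) * (a * b))" by simp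
  also have "\<dots> \<le> 2 * \<epsilon> * ((a + b + 1) * (a + b) * ((a + 1) * (b + 1)))"
    using poly assms(3) by (intro mult_left_mono) auto
  also have "\<dots> = (2 * \<epsilon> * (a + b + 1)) * ((a + b) * ((a + 1) * (b + 1)))" by (simp add: algebra_simps)
  finally have "q * (a * b) \<le> 2 * \<epsilon> * (a + b + 1)" using pos by (simp only: mult_le_cancel_right_pos)
  then show ?thesis by (simp add: a_def b_def mult.assoc)
qed

section \<open>Change of measure along the history\<close>

abbreviation std_gaussian :: "real measure" where
  "std_gaussian \<equiv> density lborel std_normal_density"

lemma prob_space_std_gaussian: "prob_space std_gaussian"
  by (rule prob_space_normal_density) simp

text \<open>The action is part of the result, so the whole recorded triple is a function of action
  and noise, and the signal enters its first component only.\<close>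

definition observe :: "(nat \<Rightarrow> real) \<Rightarrow> nat \<times> real \<Rightarrow> real \<Rightarrow> real \<times> nat \<times> real" where
  "observe x p w = (if snd p = 0 then 0 else x (fst p) + inverse (snd p) * w, p)"

text \<open>
  The density of an observation under the signal \<open>x'\<close> relative to \<open>x\<close>, for \<open>y\<close> normal with mean \<open>x a\<close>
  and variance \<open>1 / g\<^sup>2\<close>; for \<open>g = 0\<close> it is \<open>1\<close>, matching the dummy observation.
\<close>

definition likelihood_ratio :: "(nat \<Rightarrow> real) \<Rightarrow> (nat \<Rightarrow> real) \<Rightarrow> real \<times> nat \<times> real \<Rightarrow> real" where
  "likelihood_ratio x x' = (\<lambda>(y, a, g).
     exp (g\<^sup>2 * (x' a - x a) * (y - x a) - g\<^sup>2 * (x' a - x a)\<^sup>2 / 2))"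

lemma likelihood_ratio_pos [simp]: "0 < likelihood_ratio x x' b"
  by (simp add: likelihood_ratio_def case_prod_beta')

lemma measurable_fst_action [measurable]:
  "(\<lambda>p. x (fst p)) \<in> borel_measurable (action_space n)" for x :: "nat \<Rightarrow> real"
  unfolding action_space_def by (rule measurable_compose[OF measurable_fst]) simp

lemma measurable_snd_action [measurable]: "snd \<in> borel_measurable (action_space n)"
  unfolding action_space_def by simp

lemma measurable_observe [measurable]:
  "(\<lambda>q. observe x (fst q) (snd q)) \<in> action_space n \<Otimes>\<^sub>M borel \<rightarrow>\<^sub>M obs_space n"
  unfolding observe_def obs_space_def by measurable

lemma measurable_likelihood_ratio [measurable]:
  "likelihood_ratio x x' \<in> borel_measurable (obs_space n)"
proof -
  have [measurable]: "(\<lambda>b. x (fst (snd b))) \<in> borel_measurable (obs_space n)" for x :: "nat \<Rightarrow> real"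
    unfolding obs_space_def by (rule measurable_compose[OF measurable_snd measurable_fst_action])
  have [measurable]: "(\<lambda>b. snd (snd b)) \<in> borel_measurable (obs_space n)"
    unfolding obs_space_def by (rule measurable_compose[OF measurable_snd measurable_snd_action])
  have [measurable]: "fst \<in> borel_measurable (obs_space n)"
    unfolding obs_space_def by simp
  show ?thesis
    unfolding likelihood_ratio_def case_prod_beta' by measurable
qed

text \<open>Under \<open>x\<close> the quantity \<open>g * (y - x a)\<close> is the noise itself, so
  the ratio is the exponential of a Gaussian shift by the drift \<open>g * (x' a - x a)\<close>. For
  \<open>g = 0\<close> both sides are \<open>1\<close>.\<close>

lemma likelihood_ratio_observe:
  "likelihood_ratio x x' (observe x (a, g) w) = exp (g * (x' a - x a) * w - (g * (x' a - x a))\<^sup>2 / 2)"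
  by (cases "g = 0") (simp_all add: likelihood_ratio_def observe_def power2_eq_square field_simps)

text \<open>The one-dimensional Cameron-Martin formula: translate Lebesgue measure and expand the
  square in the Gaussian density.\<close>

lemma nn_integral_gaussian_shift:
  assumes [measurable]: "f \<in> borel_measurable borel"
  shows "(\<integral>\<^sup>+w. f (w + c) \<partial>std_gaussian) = (\<integral>\<^sup>+w. ennreal (exp (c * w - c\<^sup>2 / 2)) * f w \<partial>std_gaussian)"
proof -
  have eq: "std_normal_density (w - c) = std_normal_density w * exp (c * w - c\<^sup>2 / 2)" for w
    by (simp add: std_normal_density_def exp_add[symmetric] power2_eq_square field_simps)
  have "(\<integral>\<^sup>+w. f (w + c) \<partial>std_gaussian) = (\<integral>\<^sup>+w. ennreal (std_normal_density w) * f (w + c) \<partial>lborel)"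
    by (simp add: nn_integral_density)
  also have "\<dots> = (\<integral>\<^sup>+w. ennreal (std_normal_density (- c + w)) * f w \<partial>lborel)"
    by (subst (2) nn_integral_real_affine[where c = 1 and t = c]) (auto simp: add.commute)
  also have "\<dots> = (\<integral>\<^sup>+w. ennreal (std_normal_density w) * (ennreal (exp (c * w - c\<^sup>2 / 2)) * f w) \<partial>lborel)"
    using eq by (simp add: ennreal_mult' mult.assoc)
  also have "\<dots> = (\<integral>\<^sup>+w. ennreal (exp (c * w - c\<^sup>2 / 2)) * f w \<partial>std_gaussian)"
    by (simp add: nn_integral_density)
  finally show ?thesis .
qed

text \<open>For \<open>g \<noteq> 0\<close>, observing \<open>x'\<close> with noise \<open>w\<close>
  is the same as observing \<open>x\<close> with the noise shifted by the drift; for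
  \<open>g = 0\<close> the reading does not depend on the signal and the ratio is
  \<open>1\<close>.\<close>

lemma nn_integral_observe_change:
  assumes f[measurable]: "f \<in> borel_measurable (obs_space n)" and p: "p \<in> space (action_space n)"
  shows "(\<integral>\<^sup>+w. f (observe x' p w) \<partial>std_gaussian)
       = (\<integral>\<^sup>+w. ennreal (likelihood_ratio x x' (observe x p w)) * f (observe x p w) \<partial>std_gaussian)"
proof (cases p)
  case (Pair a g)
  have obs: "(\<lambda>w. observe x p w) \<in> borel \<rightarrow>\<^sub>M obs_space n"
    using measurable_compose[OF measurable_Pair1'[OF p] measurable_observe] by simp
  show ?thesis
  proof (cases "g = 0")
    case True
    then show ?thesis
      unfolding Pair likelihood_ratio_observe by (simp add: observe_def)
  next
    case False
    have "observe x' p w = observe x p (w + g * (x' a - x a))" for w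
      using False by (simp add: Pair observe_def field_simps)
    then show ?thesis
      using nn_integral_gaussian_shift[of "\<lambda>w. f (observe x p w)" "g * (x' a - x a)"] measurable_compose[OF obs f]
      by (simp add: Pair likelihood_ratio_observe)
  qed
qed

lemma measurable_history_update:
  "(\<lambda>q. (fst (fst q))(k := observe x (snd (fst q)) (snd q)))
     \<in> (history_space n k \<Otimes>\<^sub>M action_space n) \<Otimes>\<^sub>M borel \<rightarrow>\<^sub>M history_space n (Suc k)"
  unfolding history_space_def
proof (rule measurable_fun_upd[where J = "{..<k}"])
  have "(\<lambda>q. (snd (fst q), snd q)) \<in> (Pi\<^sub>M {..<k} (\<lambda>i. obs_space n) \<Otimes>\<^sub>M action_space n) \<Otimes>\<^sub>M borel
      \<rightarrow>\<^sub>M action_space n \<Otimes>\<^sub>M borel"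
    by measurable
  from measurable_compose[OF this measurable_observe[of x]]
  show "(\<lambda>q. observe x (snd (fst q)) (snd q))
      \<in> (Pi\<^sub>M {..<k} (\<lambda>i. obs_space n) \<Otimes>\<^sub>M action_space n) \<Otimes>\<^sub>M borel \<rightarrow>\<^sub>M obs_space n"
    by simp
qed auto

section \<open>The law of the history, one step at a time\<close>

context adaptive_sensing
begin

abbreviation hist :: "nat \<Rightarrow> 'w \<Rightarrow> nat \<Rightarrow> real \<times> nat \<times> real" where
  "hist \<equiv> history Y A \<Gamma>"

lemma noise_measurable [measurable]: "W k \<in> borel_measurable M"
  using distributed_measurable[OF noise_standard_normal[of k]] by simp

lemma action_measurable [measurable]: "(\<lambda>\<omega>. (A k \<omega>, \<Gamma> k \<omega>)) \<in> M \<rightarrow>\<^sub>M action_space n"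
  unfolding action_space_def using entry_measurable precision_measurable by measurable

lemma observation_eq_observe:
  assumes "\<omega> \<in> space M"
  shows "(Y k \<omega>, A k \<omega>, \<Gamma> k \<omega>) = observe x (A k \<omega>, \<Gamma> k \<omega>) (W k \<omega>)"
  using observation[OF assms, of k] by (simp add: observe_def)

lemma observation_measurable [measurable]: "(\<lambda>\<omega>. (Y k \<omega>, A k \<omega>, \<Gamma> k \<omega>)) \<in> M \<rightarrow>\<^sub>M obs_space n"
proof -
  have "(\<lambda>\<omega>. ((A k \<omega>, \<Gamma> k \<omega>), W k \<omega>)) \<in> M \<rightarrow>\<^sub>M action_space n \<Otimes>\<^sub>M borel"
    by measurable
  from measurable_compose[OF this measurable_observe[of x]]
  have "(\<lambda>\<omega>. observe x (A k \<omega>, \<Gamma> k \<omega>) (W k \<omega>)) \<in> M \<rightarrow>\<^sub>M obs_space n"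
    by simp
  then show ?thesis
    by (rule measurable_cong[THEN iffD1, rotated]) (simp add: observation_eq_observe)
qed

lemma history_measurable [measurable]: "hist k \<in> M \<rightarrow>\<^sub>M history_space n k"
  unfolding history_space_def history_def[abs_def] by (intro measurable_restrict observation_measurable)

lemma data_measurable [measurable]: "data Y A \<Gamma> \<in> M \<rightarrow>\<^sub>M data_space n"
proof -
  have "(\<lambda>\<omega>. \<lambda>i\<in>UNIV. (Y i \<omega>, A i \<omega>, \<Gamma> i \<omega>)) \<in> M \<rightarrow>\<^sub>M data_space n"
    unfolding data_space_def by (intro measurable_restrict observation_measurable)
  then show ?thesis by (simp add: data_def[abs_def] restrict_UNIV)
qed

lemma history_Suc:
  assumes "\<omega> \<in> space M"
  shows "hist (Suc k) \<omega> = (hist k \<omega>)(k := observe x (A k \<omega>, \<Gamma> k \<omega>) (W k \<omega>))"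
  unfolding observation_eq_observe[OF assms, symmetric] by (auto simp: history_def fun_eq_iff restrict_def)

lemma distr_noise: "distr M borel (W k) = std_gaussian"
proof -
  have "distr M borel (W k) = distr M lborel (W k)" by (rule distr_cong) auto
  also have "\<dots> = std_gaussian"
    using distributed_distr_eq_density[OF noise_standard_normal[of k]] by simp
  finally show ?thesis .
qed

text \<open>The noise is integrated first, by its independence of history and action, and then the
  action, by its conditional distribution. Iterated, this determines the law of the history from
  \<open>x\<close> and \<open>K\<close> alone, whatever the underlying probability space.\<close>

lemma nn_integral_history_Suc:
  assumes f[measurable]: "f \<in> borel_measurable (history_space n (Suc k))"
  shows "(\<integral>\<^sup>+\<omega>. f (hist (Suc k) \<omega>) \<partial>M)
       = (\<integral>\<^sup>+\<omega>. \<integral>\<^sup>+p. \<integral>\<^sup>+w. f ((hist k \<omega>)(k := observe x p w)) \<partial>std_gaussian \<partial>K k (hist k \<omega>) \<partial>M)"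
proof -
  interpret G: prob_space std_gaussian by (rule prob_space_std_gaussian)
  let ?HA = "history_space n k \<Otimes>\<^sub>M action_space n"
  let ?u = "\<lambda>q. (fst (fst q))(k := observe x (snd (fst q)) (snd q))"
  have fu[measurable]: "(\<lambda>q. f (?u q)) \<in> borel_measurable (?HA \<Otimes>\<^sub>M borel)"
    by (rule measurable_compose[OF measurable_history_update f])
  have fu'[measurable]: "(\<lambda>q. f (?u q)) \<in> borel_measurable (?HA \<Otimes>\<^sub>M std_gaussian)"
    using fu by (simp cong: measurable_cong_sets)
  have "(\<integral>\<^sup>+\<omega>. f (hist (Suc k) \<omega>) \<partial>M) = (\<integral>\<^sup>+\<omega>. f (?u ((hist k \<omega>, (A k \<omega>, \<Gamma> k \<omega>)), W k \<omega>)) \<partial>M)"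
    by (intro nn_integral_cong) (simp add: history_Suc)
  also have "\<dots> = (\<integral>\<^sup>+\<omega>. \<integral>\<^sup>+w. f (?u ((hist k \<omega>, (A k \<omega>, \<Gamma> k \<omega>)), w)) \<partial>std_gaussian \<partial>M)"
    unfolding distr_noise[symmetric, of k]
    by (rule nn_integral_indep_set[OF _ _ noise_indep fu]) measurable
  also have "\<dots> = (\<integral>\<^sup>+\<omega>. \<integral>\<^sup>+p. \<integral>\<^sup>+w. f (?u ((hist k \<omega>, p), w)) \<partial>std_gaussian \<partial>K k (hist k \<omega>) \<partial>M)"
    by (rule nn_integral_regular_conditional_distribution[where T = "action_space n" and H = "history_space n k"
          and f = "\<lambda>r. \<integral>\<^sup>+w. f (?u (r, w)) \<partial>std_gaussian"])
      (use strategy action_cond_distribution G.borel_measurable_nn_integral_fst[OF fu'] in \<open>auto simp: sensing_strategy_def\<close>)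
  finally show ?thesis by simp
qed

end

lemma prod_likelihood_ratio_measurable [measurable]:
  "(\<lambda>h. \<Prod>i<k. likelihood_ratio x x' (h i)) \<in> borel_measurable (history_space n k)"
  unfolding history_space_def
  by (intro borel_measurable_prod measurable_compose[OF _ measurable_likelihood_ratio[where n = n]]
    measurable_component_singleton) auto

text \<open>Both experiments draw their actions from the same kernels, so only the densities of the
  readings differ. The claim is about arbitrary integrands \<open>f\<close> so that the induction
  hypothesis applies to the integral of \<open>f\<close> over the last step.\<close>

lemma nn_integral_history_change:
  assumes "adaptive_sensing M n m x K Y A \<Gamma> W" and "adaptive_sensing M' n m' x' K Y' A' \<Gamma>' W'"
    and "f \<in> borel_measurable (history_space n k)"
  shows "(\<integral>\<^sup>+\<omega>. f (history Y' A' \<Gamma>' k \<omega>) \<partial>M')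
       = (\<integral>\<^sup>+\<omega>. ennreal (\<Prod>i<k. likelihood_ratio x x' (history Y A \<Gamma> k \<omega> i)) * f (history Y A \<Gamma> k \<omega>) \<partial>M)"
  using assms(3)
proof (induction k arbitrary: f)
  interpret P: adaptive_sensing M n m x K Y A \<Gamma> W by fact
  interpret Q: adaptive_sensing M' n m' x' K Y' A' \<Gamma>' W' by fact
  interpret G: prob_space std_gaussian by (rule prob_space_std_gaussian)
  {
    case 0
    show ?case by (simp add: history_def P.emeasure_space_1 Q.emeasure_space_1)
  next
    case (Suc k)
    note f[measurable] = Suc.prems
    let ?L = "\<lambda>k h. ennreal (\<Prod>i<k. likelihood_ratio x x' (h i))"
    let ?F = "\<lambda>h. ?L (Suc k) h * f h"
    have K: "K k \<in> history_space n k \<rightarrow>\<^sub>M prob_algebra (action_space n)"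
      using P.strategy by (simp add: sensing_strategy_def)
    let ?G = "\<lambda>x h. \<integral>\<^sup>+p. \<integral>\<^sup>+w. f (h(k := observe x p w)) \<partial>std_gaussian \<partial>K k h"
    have G[measurable]: "?G x' \<in> borel_measurable (history_space n k)"
    proof (rule nn_integral_measurable_subprob_algebra2[OF _ measurable_prob_algebraD[OF K]])
      have "(\<lambda>q. f ((fst (fst q))(k := observe x' (snd (fst q)) (snd q))))
          \<in> borel_measurable ((history_space n k \<Otimes>\<^sub>M action_space n) \<Otimes>\<^sub>M borel)"
        by (rule measurable_compose[OF measurable_history_update f])
      then have "(\<lambda>q. f ((fst (fst q))(k := observe x' (snd (fst q)) (snd q))))
          \<in> borel_measurable ((history_space n k \<Otimes>\<^sub>M action_space n) \<Otimes>\<^sub>M std_gaussian)"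
        by (simp cong: measurable_cong_sets)
      from G.borel_measurable_nn_integral_fst[OF this]
      show "(\<lambda>(h, p). \<integral>\<^sup>+w. f (h(k := observe x' p w)) \<partial>std_gaussian)
          \<in> borel_measurable (history_space n k \<Otimes>\<^sub>M action_space n)"
        by (simp add: case_prod_beta')
    qed
    \<comment> \<open>For a fixed history, a last step under \<open>x'\<close> weighted by the ratio
      so far equals a last step under \<open>x\<close> weighted by the ratio including time
      \<open>k\<close>.\<close>
    have step: "?L k h * ?G x' h
        = (\<integral>\<^sup>+p. \<integral>\<^sup>+w. ?F (h(k := observe x p w)) \<partial>std_gaussian \<partial>K k h)"
      if h: "h \<in> space (history_space n k)" for h
    proof -
      have Kh: "sets (K k h) = sets (action_space n)" "space (K k h) = space (action_space n)"
        using measurable_space[OF K h] by (auto simp: space_prob_algebra dest: sets_eq_imp_space_eq)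
      have fh: "(\<lambda>b. f (h(k := b))) \<in> borel_measurable (obs_space n)"
      proof (rule measurable_compose[OF _ f])
        show "(\<lambda>b. h(k := b)) \<in> obs_space n \<rightarrow>\<^sub>M history_space n (Suc k)"
          unfolding history_space_def
          by (rule measurable_fun_upd[where J = "{..<k}"]) (use h in \<open>auto simp: history_space_def\<close>)
      qed
      \<comment> \<open>The update at \<open>k\<close> does not touch the earlier coordinates, so
        the product splits off one factor.\<close>
      have L: "?L (Suc k) (h(k := b)) = ?L k h * ennreal (likelihood_ratio x x' b)" for b
        by (simp add: ennreal_mult' prod_nonneg less_imp_le)
      have obs[measurable]: "(\<lambda>w. observe x p w) \<in> borel \<rightarrow>\<^sub>M obs_space n" if "p \<in> space (action_space n)" for x p
        using measurable_compose[OF measurable_Pair1'[OF that] measurable_observe] by simp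
      have inner: "(\<integral>\<^sup>+w. ?F (h(k := observe x p w)) \<partial>std_gaussian)
          = ?L k h * (\<integral>\<^sup>+w. f (h(k := observe x' p w)) \<partial>std_gaussian)" if p: "p \<in> space (action_space n)" for p
      proof -
        have "(\<integral>\<^sup>+w. ?F (h(k := observe x p w)) \<partial>std_gaussian)
            = (\<integral>\<^sup>+w. ?L k h * (ennreal (likelihood_ratio x x' (observe x p w)) * f (h(k := observe x p w))) \<partial>std_gaussian)"
          by (simp only: L mult.assoc)
        also have "\<dots> = ?L k h * (\<integral>\<^sup>+w. ennreal (likelihood_ratio x x' (observe x p w)) * f (h(k := observe x p w)) \<partial>std_gaussian)"
          using measurable_compose[OF obs[OF p] fh] measurable_compose[OF obs[OF p] measurable_likelihood_ratio]
          by (intro nn_integral_cmult) simp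
        also have "\<dots> = ?L k h * (\<integral>\<^sup>+w. f (h(k := observe x' p w)) \<partial>std_gaussian)"
          using nn_integral_observe_change[OF fh p, of x' x] by simp
        finally show ?thesis .
      qed
      have "(\<integral>\<^sup>+p. \<integral>\<^sup>+w. ?F (h(k := observe x p w)) \<partial>std_gaussian \<partial>K k h)
          = (\<integral>\<^sup>+p. ?L k h * (\<integral>\<^sup>+w. f (h(k := observe x' p w)) \<partial>std_gaussian) \<partial>K k h)"
        by (intro nn_integral_cong inner) (simp add: Kh)
      also have "\<dots> = ?L k h * ?G x' h"
      proof (rule nn_integral_cmult)
        have "(\<lambda>q. f (h(k := observe x' (fst q) (snd q)))) \<in> borel_measurable (action_space n \<Otimes>\<^sub>M std_gaussian)"
          using measurable_compose[OF measurable_observe fh] by (simp cong: measurable_cong_sets)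
        from G.borel_measurable_nn_integral_fst[OF this]
        show "(\<lambda>p. \<integral>\<^sup>+w. f (h(k := observe x' p w)) \<partial>std_gaussian) \<in> borel_measurable (K k h)"
          by (simp cong: measurable_cong_sets add: Kh)
      qed
      finally show ?thesis ..
    qed
    \<comment> \<open>Split off the last step under \<open>x'\<close>, change measure on the shorter
      history, change it in the last step, and reassemble under \<open>x\<close>.\<close>
    have "(\<integral>\<^sup>+\<omega>. f (history Y' A' \<Gamma>' (Suc k) \<omega>) \<partial>M') = (\<integral>\<^sup>+\<omega>. ?G x' (history Y' A' \<Gamma>' k \<omega>) \<partial>M')"
      by (rule Q.nn_integral_history_Suc[OF f])
    also have "\<dots> = (\<integral>\<^sup>+\<omega>. ?L k (history Y A \<Gamma> k \<omega>) * ?G x' (history Y A \<Gamma> k \<omega>) \<partial>M)"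
      by (rule Suc.IH[OF G])
    also have "\<dots> = (\<integral>\<^sup>+\<omega>. \<integral>\<^sup>+p. \<integral>\<^sup>+w. ?F ((history Y A \<Gamma> k \<omega>)(k := observe x p w)) \<partial>std_gaussian \<partial>K k (history Y A \<Gamma> k \<omega>) \<partial>M)"
      by (intro nn_integral_cong step measurable_space[OF P.history_measurable])
    also have "\<dots> = (\<integral>\<^sup>+\<omega>. ?F (history Y A \<Gamma> (Suc k) \<omega>) \<partial>M)"
      by (rule P.nn_integral_history_Suc[symmetric]) measurable
    finally show ?case .
  }
qed

section \<open>Testing error and expected precision\<close>

text \<open>Passes from independent families of events to random variables, for which expectations
  of products factor. Preimages of Borel sets are closed under intersection, so independence extends
  to the sigma-algebras they generate.\<close>

lemma (in prob_space) indep_var_of_indep_set: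
  fixes U V :: "'a \<Rightarrow> real"
  assumes indep: "indep_set F G"
    and U: "U \<in> borel_measurable M" "\<And>B. B \<in> sets borel \<Longrightarrow> U -` B \<inter> space M \<in> G"
    and V: "V \<in> borel_measurable M" "\<And>B. B \<in> sets borel \<Longrightarrow> V -` B \<inter> space M \<in> F"
  shows "indep_var borel U borel V"
proof (subst indep_var_eq, intro conjI U V indep_set_sigma_sets)
  show "indep_set {U -` B \<inter> space M |B. B \<in> sets borel} {V -` B \<inter> space M |B. B \<in> sets borel}"
    unfolding indep_sets2_eq
  proof (intro conjI ballI)
    fix a b assume "a \<in> {U -` B \<inter> space M |B. B \<in> sets borel}" "b \<in> {V -` B \<inter> space M |B. B \<in> sets borel}"
    then have "a \<in> G" "b \<in> F" using U(2) V(2) by auto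
    then show "prob (a \<inter> b) = prob a * prob b"
      using indep unfolding indep_sets2_eq by (metis Int_commute mult.commute)
  qed (use measurable_sets[OF U(1)] measurable_sets[OF V(1)] in auto)
next
  show "Int_stable {U -` B \<inter> space M |B. B \<in> sets borel}" for U :: "'a \<Rightarrow> real"
  proof (rule Int_stableI, safe)
    fix B C :: "real set" assume "B \<in> sets borel" "C \<in> sets borel"
    then show "\<exists>D. U -` B \<inter> space M \<inter> (U -` C \<inter> space M) = U -` D \<inter> space M \<and> D \<in> sets borel"
      by (intro exI[of _ "B \<inter> C"]) auto
  qed
  then show "Int_stable {V -` B \<inter> space M |B. B \<in> sets borel}" .
qed

section \<open>Moments of the log-likelihood increments and expected precision per entry\<close>

context adaptive_sensing
begin

lemma noise_integrable: "integrable M (W k)"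
  using distributed_integrable[OF noise_standard_normal[of k], of "\<lambda>w. w"] integrable_std_normal_moment[of 1]
  by simp

lemma noise_expectation: "expectation (W k) = 0"
  by (rule standard_normal_distributed_expectation[OF noise_standard_normal])

lemma measurable_entry [measurable]: "(\<lambda>\<omega>. d (A k \<omega>)) \<in> borel_measurable M" for d :: "nat \<Rightarrow> real"
  by (rule measurable_compose[OF entry_measurable]) simp

lemma entry_range: "\<omega> \<in> space M \<Longrightarrow> A k \<omega> \<in> {1..n}"
  using measurable_space[OF entry_measurable] by simp

declare precision_measurable [measurable]

lemma precision_bounded:
  assumes "0 \<le> m"
  shows "AE \<omega> in M. (\<Gamma> k \<omega>)\<^sup>2 \<le> m"
  using budget
proof eventually_elim
  case (elim \<omega>)
  have "ennreal ((\<Gamma> k \<omega>)\<^sup>2) = (\<Sum>i\<in>{k}. ennreal ((\<Gamma> i \<omega>)\<^sup>2))" by simp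
  also have "\<dots> \<le> (\<Sum>i. ennreal ((\<Gamma> i \<omega>)\<^sup>2))" by (intro sum_le_suminf) auto
  finally show ?case using elim assms by (metis order_trans ennreal_le_iff)
qed

text \<open>Each squared precision is almost surely at most the budget, and there are finitely many
  entries. This boundedness yields the integrability of the drift and of its square.\<close>

lemma drift_bounded:
  fixes d :: "nat \<Rightarrow> real"
  assumes "0 \<le> m"
  shows "AE \<omega> in M. \<bar>\<Gamma> k \<omega> * d (A k \<omega>)\<bar> \<le> sqrt m * (\<Sum>a\<in>{1..n}. \<bar>d a\<bar>)"
  using precision_bounded[OF assms, of k] AE_space
proof eventually_elim
  case (elim \<omega>)
  have "\<bar>\<Gamma> k \<omega>\<bar> \<le> sqrt m" using elim by (simp add: real_le_rsqrt)
  moreover have "\<bar>d (A k \<omega>)\<bar> \<le> (\<Sum>a\<in>{1..n}. \<bar>d a\<bar>)"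
    using entry_range elim by (intro member_le_sum) auto
  ultimately show ?case unfolding abs_mult by (intro mult_mono) (auto simp: assms)
qed

lemma drift_integrable:
  fixes d :: "nat \<Rightarrow> real"
  assumes "0 \<le> m"
  shows "integrable M (\<lambda>\<omega>. \<Gamma> k \<omega> * d (A k \<omega>))" "integrable M (\<lambda>\<omega>. (\<Gamma> k \<omega> * d (A k \<omega>))\<^sup>2)"
proof -
  show "integrable M (\<lambda>\<omega>. \<Gamma> k \<omega> * d (A k \<omega>))"
    using drift_bounded[OF assms, of k d] by (intro integrable_const_bound) auto
  show "integrable M (\<lambda>\<omega>. (\<Gamma> k \<omega> * d (A k \<omega>))\<^sup>2)"
  proof (rule integrable_const_bound)
    show "AE \<omega> in M. norm ((\<Gamma> k \<omega> * d (A k \<omega>))\<^sup>2) \<le> (sqrt m * (\<Sum>a\<in>{1..n}. \<bar>d a\<bar>))\<^sup>2"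
      using drift_bounded[OF assms, of k d]
    proof eventually_elim
      case (elim \<omega>)
      then have "\<bar>\<Gamma> k \<omega> * d (A k \<omega>)\<bar>\<^sup>2 \<le> (sqrt m * (\<Sum>a\<in>{1..n}. \<bar>d a\<bar>))\<^sup>2" by (intro power_mono) auto
      then show ?case by (simp only: power2_abs real_norm_def abs_power2)
    qed
  qed measurable
qed

text \<open>The drift is a function of history and action, hence independent of the centred noise
  \<open>W k\<close>; its product with the noise therefore drops out of the expected
  log-likelihood.\<close>

lemma
  fixes d :: "nat \<Rightarrow> real"
  assumes "0 \<le> m"
  shows drift_noise_integrable: "integrable M (\<lambda>\<omega>. \<Gamma> k \<omega> * d (A k \<omega>) * W k \<omega>)"
    and drift_noise_expectation: "expectation (\<lambda>\<omega>. \<Gamma> k \<omega> * d (A k \<omega>) * W k \<omega>) = 0"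
proof -
  have meas: "(\<lambda>q. snd (snd q) * d (fst (snd q))) \<in> borel_measurable (history_space n k \<Otimes>\<^sub>M action_space n)"
    using measurable_compose[OF measurable_snd measurable_snd_action]
      measurable_compose[OF measurable_snd measurable_fst_action, of d] by (intro borel_measurable_times) auto
  have "indep_var borel (\<lambda>\<omega>. \<Gamma> k \<omega> * d (A k \<omega>)) borel (W k)"
  proof (rule indep_var_of_indep_set[OF noise_indep[of k]])
    fix B :: "real set" assume B: "B \<in> sets borel"
    then show "W k -` B \<inter> space M \<in> sets (vimage_algebra (space M) (W k) borel)"
      by (rule in_vimage_algebra)
    let ?C = "(\<lambda>q. snd (snd q) * d (fst (snd q))) -` B \<inter> space (history_space n k \<Otimes>\<^sub>M action_space n)"
    have "(\<lambda>\<omega>. (hist k \<omega>, (A k \<omega>, \<Gamma> k \<omega>))) -` ?C \<inter> space M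
        \<in> sets (vimage_algebra (space M) (\<lambda>\<omega>. (hist k \<omega>, (A k \<omega>, \<Gamma> k \<omega>))) (history_space n k \<Otimes>\<^sub>M action_space n))"
      by (rule in_vimage_algebra[OF measurable_sets[OF meas B]])
    moreover have "(\<lambda>\<omega>. (hist k \<omega>, (A k \<omega>, \<Gamma> k \<omega>))) -` ?C \<inter> space M
        = (\<lambda>\<omega>. \<Gamma> k \<omega> * d (A k \<omega>)) -` B \<inter> space M"
      using measurable_space[OF history_measurable[of k]] measurable_space[OF action_measurable[of k]]
      by (auto simp: space_pair_measure)
    ultimately show "(\<lambda>\<omega>. \<Gamma> k \<omega> * d (A k \<omega>)) -` B \<inter> space M
        \<in> sets (vimage_algebra (space M) (\<lambda>\<omega>. (hist k \<omega>, (A k \<omega>, \<Gamma> k \<omega>))) (history_space n k \<Otimes>\<^sub>M action_space n))"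
      by simp
  qed measurable
  note * = this drift_integrable(1)[OF assms] noise_integrable
  show "integrable M (\<lambda>\<omega>. \<Gamma> k \<omega> * d (A k \<omega>) * W k \<omega>)"
    by (rule indep_var_integrable[OF *])
  show "expectation (\<lambda>\<omega>. \<Gamma> k \<omega> * d (A k \<omega>) * W k \<omega>) = 0"
    using indep_var_lebesgue_integral[OF *] by (simp add: noise_expectation)
qed

lemma likelihood_ratio_history:
  assumes "\<omega> \<in> space M" "i < k"
  shows "likelihood_ratio x x' (hist k \<omega> i)
       = exp (\<Gamma> i \<omega> * (x' (A i \<omega>) - x (A i \<omega>)) * W i \<omega> - (\<Gamma> i \<omega> * (x' (A i \<omega>) - x (A i \<omega>)))\<^sup>2 / 2)"
  using assms observation_eq_observe[OF assms(1), of i] by (simp add: history_def likelihood_ratio_observe)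

lemma restrict_data: "restrict (data Y A \<Gamma> \<omega>) {..<k} = hist k \<omega>"
  by (simp add: data_def history_def)

text \<open>The series is taken in the extended nonnegative reals, where it always exists;
  \<open>nn_energy_le\<close> bounds its integral by \<open>m\<close>, so \<open>enn2real\<close>
  loses nothing.\<close>

definition energy :: "nat \<Rightarrow> real" where
  "energy j = enn2real (\<integral>\<^sup>+\<omega>. (\<Sum>i. ennreal ((\<Gamma> i \<omega>)\<^sup>2 * indicator {j} (A i \<omega>))) \<partial>M)"

lemma nn_energy_le: "(\<integral>\<^sup>+\<omega>. (\<Sum>i. ennreal ((\<Gamma> i \<omega>)\<^sup>2 * indicator {j} (A i \<omega>))) \<partial>M) \<le> ennreal m"
proof -
  have "(\<integral>\<^sup>+\<omega>. (\<Sum>i. ennreal ((\<Gamma> i \<omega>)\<^sup>2 * indicator {j} (A i \<omega>))) \<partial>M) \<le> (\<integral>\<^sup>+\<omega>. ennreal m \<partial>M)"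
    using budget
  proof (intro nn_integral_mono_AE, eventually_elim)
    case (elim \<omega>)
    have "(\<Sum>i. ennreal ((\<Gamma> i \<omega>)\<^sup>2 * indicator {j} (A i \<omega>))) \<le> (\<Sum>i. ennreal ((\<Gamma> i \<omega>)\<^sup>2))"
      by (intro suminf_le ennreal_leI) (auto simp: indicator_def)
    with elim show ?case by simp
  qed
  then show ?thesis by (simp add: emeasure_space_1)
qed

lemma partial_energy_le:
  assumes "0 \<le> m"
  shows "(\<Sum>i<k. expectation (\<lambda>\<omega>. (\<Gamma> i \<omega>)\<^sup>2 * indicator {j} (A i \<omega>))) \<le> energy j"
proof -
  let ?g = "\<lambda>i \<omega>. (\<Gamma> i \<omega>)\<^sup>2 * indicat_real {j} (A i \<omega>)"
  have int: "integrable M (?g i)" for i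
  proof -
    have "?g i = (\<lambda>\<omega>. (\<Gamma> i \<omega> * indicator {j} (A i \<omega>))\<^sup>2)"
      by (auto simp: fun_eq_iff indicator_def)
    then show ?thesis using drift_integrable(2)[OF assms, of i "indicator {j}"] by simp
  qed
  have "ennreal (\<Sum>i<k. expectation (?g i)) = (\<Sum>i<k. ennreal (expectation (?g i)))"
    by (rule sum_ennreal[symmetric]) (auto intro!: integral_nonneg_AE)
  also have "\<dots> = (\<Sum>i<k. \<integral>\<^sup>+\<omega>. ennreal (?g i \<omega>) \<partial>M)"
    by (intro sum.cong nn_integral_eq_integral[symmetric] int) auto
  also have "\<dots> = (\<integral>\<^sup>+\<omega>. (\<Sum>i<k. ennreal (?g i \<omega>)) \<partial>M)"
    by (intro nn_integral_sum[symmetric]) measurable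
  also have "\<dots> \<le> (\<integral>\<^sup>+\<omega>. (\<Sum>i. ennreal (?g i \<omega>)) \<partial>M)"
    by (intro nn_integral_mono sum_le_suminf) auto
  also have "\<dots> = ennreal (energy j)"
    unfolding energy_def using nn_energy_le[of j] by (subst ennreal_enn2real) (auto simp: less_top[symmetric] top_unique)
  finally show ?thesis by (simp add: energy_def)
qed

text \<open>At each time exactly one entry in \<open>{1..n}\<close> is measured, so the indicators
  add up to \<open>1\<close> and the budget applies path by path.\<close>

lemma sum_energy_le:
  assumes "0 \<le> m"
  shows "(\<Sum>j\<in>{1..n}. energy j) \<le> m"
proof -
  let ?g = "\<lambda>j i \<omega>. ennreal ((\<Gamma> i \<omega>)\<^sup>2 * indicator {j} (A i \<omega>))"
  have "ennreal (\<Sum>j\<in>{1..n}. energy j) = (\<Sum>j\<in>{1..n}. ennreal (energy j))"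
    by (rule sum_ennreal[symmetric]) (simp add: energy_def)
  also have "\<dots> = (\<Sum>j\<in>{1..n}. \<integral>\<^sup>+\<omega>. (\<Sum>i. ?g j i \<omega>) \<partial>M)"
  proof (rule sum.cong[OF refl])
    show "ennreal (energy j) = (\<integral>\<^sup>+\<omega>. (\<Sum>i. ?g j i \<omega>) \<partial>M)" for j
      unfolding energy_def using nn_energy_le[of j] by (subst ennreal_enn2real) (auto simp: less_top[symmetric] top_unique)
  qed
  also have "\<dots> = (\<integral>\<^sup>+\<omega>. (\<Sum>j\<in>{1..n}. \<Sum>i. ?g j i \<omega>) \<partial>M)"
    by (intro nn_integral_sum[symmetric]) measurable
  also have "\<dots> \<le> (\<integral>\<^sup>+\<omega>. ennreal m \<partial>M)"
  proof (rule nn_integral_mono_AE)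
    show "AE \<omega> in M. (\<Sum>j\<in>{1..n}. \<Sum>i. ?g j i \<omega>) \<le> ennreal m"
      using budget AE_space
    proof eventually_elim
      case (elim \<omega>)
      have "(\<Sum>j\<in>{1..n}. \<Sum>i. ?g j i \<omega>) = (\<Sum>i. \<Sum>j\<in>{1..n}. ?g j i \<omega>)"
        by (rule suminf_sum[symmetric]) auto
      also have "\<dots> = (\<Sum>i. ennreal ((\<Gamma> i \<omega>)\<^sup>2))"
      proof (rule suminf_cong)
        fix i
        have "(\<Sum>j\<in>{1..n}. ?g j i \<omega>) = (\<Sum>j\<in>{1..n}. if j = A i \<omega> then ennreal ((\<Gamma> i \<omega>)\<^sup>2) else 0)"
          by (intro sum.cong) (auto simp: indicator_def)
        then show "(\<Sum>j\<in>{1..n}. ?g j i \<omega>) = ennreal ((\<Gamma> i \<omega>)\<^sup>2)"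
          using entry_range[of \<omega> i] elim by simp
      qed
      finally show ?case using elim by simp
    qed
  qed
  finally show ?thesis using assms by (simp add: emeasure_space_1)
qed

end

text \<open>In terms of the likelihood ratio \<open>\<Lambda>\<close> of the history, the two errors
  add up to the mean under \<open>M\<close> of a function that is \<open>1\<close> on
  \<open>B\<close> and \<open>\<Lambda>\<close> off it, which dominates
  \<open>min 1 \<Lambda>\<close>. Integrating \<open>min_one_ge_affine\<close> then needs only the
  means of \<open>\<Lambda>\<close> and \<open>ln \<Lambda>\<close>.\<close>

lemma history_test_bound:
  assumes "adaptive_sensing M n m x K Y A \<Gamma> W" and "adaptive_sensing M' n m' x' K Y' A' \<Gamma>' W'"
    and m: "0 \<le> m" and B[measurable]: "B \<in> sets (history_space n k)"
  shows "exp (- c) * (1 / 2 + c / 2 - (\<Sum>i<k. \<integral>\<omega>. (\<Gamma> i \<omega> * (x' (A i \<omega>) - x (A i \<omega>)))\<^sup>2 \<partial>M) / 4)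
       \<le> measure M {\<omega> \<in> space M. history Y A \<Gamma> k \<omega> \<in> B}
         + measure M' {\<omega> \<in> space M'. history Y' A' \<Gamma>' k \<omega> \<notin> B}"
proof -
  interpret P: adaptive_sensing M n m x K Y A \<Gamma> W by fact
  interpret Q: adaptive_sensing M' n m' x' K Y' A' \<Gamma>' W' by fact
  let ?H = "history_space n k"
  define d where "d a = x' a - x a" for a
  define \<Lambda> where "\<Lambda> \<omega> = (\<Prod>i<k. likelihood_ratio x x' (history Y A \<Gamma> k \<omega> i))" for \<omega>
  define \<kappa> where "\<kappa> = (\<Sum>i<k. \<integral>\<omega>. (\<Gamma> i \<omega> * d (A i \<omega>))\<^sup>2 \<partial>M)"
  have \<Lambda>_pos: "0 < \<Lambda> \<omega>" for \<omega> by (simp add: \<Lambda>_def prod_pos)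
  have [measurable]: "\<Lambda> \<in> borel_measurable M"
    unfolding \<Lambda>_def by (rule measurable_compose[OF P.history_measurable prod_likelihood_ratio_measurable])
  \<comment> \<open>Total mass of the law under \<open>x'\<close>: the change of measure with the
    constant integrand \<open>1\<close>.\<close>
  have \<Lambda>1: "(\<integral>\<^sup>+\<omega>. ennreal (\<Lambda> \<omega>) \<partial>M) = 1"
    using nn_integral_history_change[OF assms(1,2), of "\<lambda>_. 1" k] by (simp add: \<Lambda>_def Q.emeasure_space_1)
  have \<Lambda>_int: "integrable M \<Lambda>"
    using \<Lambda>1 by (intro integrableI_nonneg) (auto simp: less_imp_le \<Lambda>_pos)
  have \<Lambda>_exp: "(\<integral>\<omega>. \<Lambda> \<omega> \<partial>M) = 1"
    using \<Lambda>1 by (subst integral_eq_nn_integral) (auto simp: less_imp_le \<Lambda>_pos)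
  define l where "l \<omega> = (\<Sum>i<k. \<Gamma> i \<omega> * d (A i \<omega>) * W i \<omega> - (\<Gamma> i \<omega> * d (A i \<omega>))\<^sup>2 / 2)" for \<omega>
  have ln\<Lambda>: "ln (\<Lambda> \<omega>) = l \<omega>" if "\<omega> \<in> space M" for \<omega>
    using that by (simp add: \<Lambda>_def l_def d_def P.likelihood_ratio_history exp_sum[symmetric])
  have l_int: "integrable M l"
    unfolding l_def
    by (intro Bochner_Integration.integrable_sum Bochner_Integration.integrable_diff integrable_divide_zero
        P.drift_noise_integrable P.drift_integrable m)
  \<comment> \<open>The noise terms have mean zero, so the Kullback-Leibler divergence between the
    two laws of the history is \<open>\<kappa> / 2\<close>.\<close>
  have l_exp: "(\<integral>\<omega>. l \<omega> \<partial>M) = - \<kappa> / 2"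
    unfolding l_def \<kappa>_def
    by (subst Bochner_Integration.integral_sum)
      (simp_all add: P.drift_noise_integrable P.drift_integrable m P.drift_noise_expectation
        sum_negf sum_divide_distrib)
  let ?C = "{\<omega> \<in> space M. history Y A \<Gamma> k \<omega> \<in> B}"
  let ?D = "{\<omega> \<in> space M. history Y A \<Gamma> k \<omega> \<notin> B}"
  let ?D' = "{\<omega> \<in> space M'. history Y' A' \<Gamma>' k \<omega> \<notin> B}"
  have [measurable]: "?C \<in> sets M" "?D \<in> sets M" "?D' \<in> sets M'" by measurable
  have D_int: "integrable M (\<lambda>\<omega>. \<Lambda> \<omega> * indicator ?D \<omega>)"
    by (rule integrable_real_mult_indicator[OF _ \<Lambda>_int]) simp
  \<comment> \<open>The error under \<open>M'\<close> becomes an integral under \<open>M\<close>.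
    The complement is taken in \<open>space ?H\<close>, which makes the indicator measurable on
    histories.\<close>
  have "ennreal (measure M' ?D') = (\<integral>\<^sup>+\<omega>. indicator (space ?H - B) (history Y' A' \<Gamma>' k \<omega>) \<partial>M')"
  proof -
    have "(\<integral>\<^sup>+\<omega>. indicator (space ?H - B) (history Y' A' \<Gamma>' k \<omega>) \<partial>M') = (\<integral>\<^sup>+\<omega>. indicator ?D' \<omega> \<partial>M')"
      using measurable_space[OF Q.history_measurable[of k]]
      by (intro nn_integral_cong) (auto simp: indicator_def)
    then show ?thesis by (simp add: Q.emeasure_eq_measure)
  qed
  also have "\<dots> = (\<integral>\<^sup>+\<omega>. ennreal (\<Lambda> \<omega>) * indicator (space ?H - B) (history Y A \<Gamma> k \<omega>) \<partial>M)"
    unfolding \<Lambda>_def by (rule nn_integral_history_change[OF assms(1,2)]) measurable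
  also have "\<dots> = (\<integral>\<^sup>+\<omega>. ennreal (\<Lambda> \<omega> * indicator ?D \<omega>) \<partial>M)"
    using measurable_space[OF P.history_measurable[of k]]
    by (intro nn_integral_cong) (auto simp: indicator_def)
  also have "\<dots> = ennreal (\<integral>\<omega>. \<Lambda> \<omega> * indicator ?D \<omega> \<partial>M)"
    by (rule nn_integral_eq_integral[OF D_int]) (auto simp: less_imp_le \<Lambda>_pos)
  finally have D': "measure M' ?D' = (\<integral>\<omega>. \<Lambda> \<omega> * indicator ?D \<omega> \<partial>M)"
    by (subst (asm) ennreal_inj) (auto intro!: integral_nonneg_AE simp: less_imp_le \<Lambda>_pos)
  let ?a = "\<lambda>\<omega>. exp (- c) * (1 + c / 2 + l \<omega> / 2 - (1 + \<Lambda> \<omega>) / 4)"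
  have a_int: "integrable M ?a"
    by (intro integrable_mult_right Bochner_Integration.integrable_diff Bochner_Integration.integrable_add
        integrable_divide_zero l_int \<Lambda>_int P.integrable_const)
  have C_int: "integrable M (indicat_real ?C)"
    by (rule P.integrable_const_bound[of _ 1]) (auto simp: indicator_def)
  have "exp (- c) * (1 / 2 + c / 2 - \<kappa> / 4) = (\<integral>\<omega>. ?a \<omega> \<partial>M)"
    by (simp add: l_int \<Lambda>_int l_exp \<Lambda>_exp P.prob_space field_simps)
  also have "\<dots> \<le> (\<integral>\<omega>. indicator ?C \<omega> + \<Lambda> \<omega> * indicator ?D \<omega> \<partial>M)"
  proof (intro integral_mono a_int Bochner_Integration.integrable_add D_int C_int)
    fix \<omega> assume \<omega>: "\<omega> \<in> space M"
    have "?a \<omega> \<le> min 1 (\<Lambda> \<omega>)"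
      using min_one_ge_affine[OF \<Lambda>_pos, of c \<omega>] by (simp only: ln\<Lambda>[OF \<omega>])
    \<comment> \<open>Every outcome lies in exactly one of \<open>?C\<close> and \<open>?D\<close>,
      so the right side is either \<open>1\<close> or \<open>\<Lambda> \<omega>\<close>.\<close>
    also have "\<dots> \<le> indicator ?C \<omega> + \<Lambda> \<omega> * indicator ?D \<omega>"
      using \<omega> by (auto simp: indicator_def)
    finally show "?a \<omega> \<le> indicator ?C \<omega> + \<Lambda> \<omega> * indicator ?D \<omega>" .
  qed
  also have "\<dots> = measure M ?C + measure M' ?D'"
    unfolding D' by (subst Bochner_Integration.integral_add[OF C_int D_int]) (simp add: Int_absorb2)
  finally show ?thesis by (simp add: \<kappa>_def d_def)
qed

text \<open>An event of the infinite data is replaced by one of a finite history, up to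
  \<open>\<eta>\<close> under both laws together, so no density of the infinite sequence is
  required. The horizon depends on \<open>\<eta>\<close>, which is why \<open>\<kappa>\<close>
  bounds the partial sums for all \<open>k\<close>.\<close>

lemma data_test_bound:
  assumes "adaptive_sensing M n m x K Y A \<Gamma> W" and "adaptive_sensing M' n m' x' K Y' A' \<Gamma>' W'"
    and m: "0 \<le> m" and E[measurable]: "E \<in> sets (data_space n)"
    and \<kappa>: "\<And>k. (\<Sum>i<k. \<integral>\<omega>. (\<Gamma> i \<omega> * (x' (A i \<omega>) - x (A i \<omega>)))\<^sup>2 \<partial>M) \<le> \<kappa>"
  shows "exp (- c) * (1 / 2 + c / 2 - \<kappa> / 4)
       \<le> measure M {\<omega> \<in> space M. data Y A \<Gamma> \<omega> \<in> E} + measure M' {\<omega> \<in> space M'. data Y' A' \<Gamma>' \<omega> \<notin> E}"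
proof (rule field_le_epsilon)
  fix \<eta> :: real assume \<eta>: "0 < \<eta>"
  interpret P: adaptive_sensing M n m x K Y A \<Gamma> W by fact
  interpret Q: adaptive_sensing M' n m' x' K Y' A' \<Gamma>' W' by fact
  let ?P = "distr M (data_space n) (data Y A \<Gamma>)"
  let ?Q = "distr M' (data_space n) (data Y' A' \<Gamma>')"
  interpret PD: prob_space ?P by (rule P.prob_space_distr) simp
  interpret QD: prob_space ?Q by (rule Q.prob_space_distr) simp
  have sets: "sets ?P = sets (\<Pi>\<^sub>M i\<in>UNIV. obs_space n)" "sets ?Q = sets (\<Pi>\<^sub>M i\<in>UNIV. obs_space n)"
    by (simp_all add: data_space_def)
  obtain k B where B: "B \<in> sets (history_space n k)"
    and *: "measure ?P (sym_diff E (prod_emb UNIV (\<lambda>_. obs_space n) {..<k} B))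
       + measure ?Q (sym_diff E (prod_emb UNIV (\<lambda>_. obs_space n) {..<k} B)) < \<eta>"
    by (rule PiM_cylinder_approximation[OF PD.finite_measure_axioms QD.finite_measure_axioms sets
          E[unfolded data_space_def] \<eta>, folded history_space_def]) (rule that)
  define F where "F = prod_emb UNIV (\<lambda>_. obs_space n) {..<k} B"
  have F[measurable]: "F \<in> sets (data_space n)"
    using B unfolding F_def data_space_def history_space_def by (intro measurable_prod_emb) auto
  have mem_F: "d \<in> F \<longleftrightarrow> restrict d {..<k} \<in> B" if "d \<in> space (data_space n)" for d
    using that by (auto simp: F_def prod_emb_def data_space_def space_PiM)
  have "measure M {\<omega> \<in> space M. history Y A \<Gamma> k \<omega> \<in> B} = measure ?P F"
    using measurable_space[OF P.data_measurable]
    by (subst measure_distr) (auto simp: mem_F P.restrict_data intro!: arg_cong[where f = "measure M"])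
  moreover have "measure M' {\<omega> \<in> space M'. history Y' A' \<Gamma>' k \<omega> \<notin> B} = measure ?Q (space (data_space n) - F)"
    using measurable_space[OF Q.data_measurable]
    by (subst measure_distr) (auto simp: mem_F Q.restrict_data intro!: arg_cong[where f = "measure M'"])
  moreover have "measure M {\<omega> \<in> space M. data Y A \<Gamma> \<omega> \<in> E} = measure ?P E"
    by (subst measure_distr) (auto intro!: arg_cong[where f = "measure M"])
  moreover have "measure M' {\<omega> \<in> space M'. data Y' A' \<Gamma>' \<omega> \<notin> E} = measure ?Q (space (data_space n) - E)"
    using measurable_space[OF Q.data_measurable]
    by (subst measure_distr) (auto intro!: arg_cong[where f = "measure M'"])
  \<comment> \<open>Replacing \<open>E\<close> by \<open>F\<close> costs at most the measure of
    their symmetric difference, here under \<open>?P\<close> and next, for the complements, under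
    \<open>?Q\<close>.\<close>
  moreover have "measure ?P F \<le> measure ?P E + measure ?P (sym_diff E F)"
  proof -
    have "measure ?P F \<le> measure ?P (E \<union> sym_diff E F)" by (intro PD.finite_measure_mono) auto
    also have "\<dots> \<le> measure ?P E + measure ?P (sym_diff E F)" by (intro measure_Un_le) auto
    finally show ?thesis .
  qed
  moreover have "measure ?Q (space (data_space n) - F) \<le> measure ?Q (space (data_space n) - E) + measure ?Q (sym_diff E F)"
  proof -
    have "measure ?Q (space (data_space n) - F) \<le> measure ?Q ((space (data_space n) - E) \<union> sym_diff E F)"
      by (intro QD.finite_measure_mono) auto
    also have "\<dots> \<le> measure ?Q (space (data_space n) - E) + measure ?Q (sym_diff E F)"
      by (intro measure_Un_le) auto
    finally show ?thesis .
  qed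
  moreover have "exp (- c) * (1 / 2 + c / 2 - \<kappa> / 4)
      \<le> measure M {\<omega> \<in> space M. history Y A \<Gamma> k \<omega> \<in> B} + measure M' {\<omega> \<in> space M'. history Y' A' \<Gamma>' k \<omega> \<notin> B}"
  proof -
    have "exp (- c) * (1 / 2 + c / 2 - \<kappa> / 4)
      \<le> exp (- c) * (1 / 2 + c / 2 - (\<Sum>i<k. \<integral>\<omega>. (\<Gamma> i \<omega> * (x' (A i \<omega>) - x (A i \<omega>)))\<^sup>2 \<partial>M) / 4)"
      using \<kappa>[of k] by (intro mult_left_mono) auto
    also note history_test_bound[OF assms(1,2) m B]
    finally show ?thesis .
  qed
  ultimately show "exp (- c) * (1 / 2 + c / 2 - \<kappa> / 4)
       \<le> measure M {\<omega> \<in> space M. data Y A \<Gamma> \<omega> \<in> E} + measure M' {\<omega> \<in> space M'. data Y' A' \<Gamma>' \<omega> \<notin> E} + \<eta>"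
    using * unfolding F_def[symmetric] by linarith
qed

section \<open>Swapping one entry of the support\<close>

text \<open>The Hamming distance is a sum of entrywise error indicators, so the risk splits into
  errors at single entries, each of which is a testing problem.\<close>

lemma (in adaptive_sensing) expected_error_eq_sum:
  assumes Shat: "Shat \<in> data_space n \<rightarrow>\<^sub>M count_space (Pow {1..n})" and T: "T \<subseteq> {1..n}"
  shows "(\<integral>\<omega>. real (card (sym_diff (Shat (data Y A \<Gamma> \<omega>)) T)) \<partial>M)
       = (\<Sum>j\<in>{1..n}. prob {\<omega> \<in> space M. j \<in> sym_diff (Shat (data Y A \<Gamma> \<omega>)) T})"
proof -
  have Sd[measurable]: "(\<lambda>\<omega>. Shat (data Y A \<Gamma> \<omega>)) \<in> M \<rightarrow>\<^sub>M count_space (Pow {1..n})"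
    by (rule measurable_compose[OF data_measurable Shat])
  let ?E = "\<lambda>j. {\<omega> \<in> space M. j \<in> sym_diff (Shat (data Y A \<Gamma> \<omega>)) T}"
  have E[measurable]: "?E j \<in> sets M" for j
  proof -
    have "?E j = (\<lambda>\<omega>. Shat (data Y A \<Gamma> \<omega>)) -` {R \<in> Pow {1..n}. j \<in> sym_diff R T} \<inter> space M"
      using measurable_space[OF Sd] by auto
    also have "\<dots> \<in> sets M" by (rule measurable_sets[OF Sd]) auto
    finally show ?thesis .
  qed
  have "(\<integral>\<omega>. real (card (sym_diff (Shat (data Y A \<Gamma> \<omega>)) T)) \<partial>M) = (\<integral>\<omega>. (\<Sum>j\<in>{1..n}. indicator (?E j) \<omega>) \<partial>M)"
  proof (rule Bochner_Integration.integral_cong[OF refl])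
    fix \<omega> assume \<omega>: "\<omega> \<in> space M"
    let ?D = "sym_diff (Shat (data Y A \<Gamma> \<omega>)) T"
    have "?D \<subseteq> {1..n}" using measurable_space[OF Sd \<omega>] T by auto
    then have "real (card ?D) = (\<Sum>j\<in>{1..n}. indicator ?D j)"
      by (simp only: card_eq_sum of_nat_sum of_nat_1)
        (rule sum.mono_neutral_cong_left, auto simp: indicator_def)
    then show "real (card ?D) = (\<Sum>j\<in>{1..n}. indicator (?E j) \<omega>)"
      using \<omega> by (simp add: indicator_def)
  qed
  also have "\<dots> = (\<Sum>j\<in>{1..n}. \<integral>\<omega>. indicator (?E j) \<omega> \<partial>M)"
    by (intro Bochner_Integration.integral_sum integrable_real_indicator E) (simp add: emeasure_eq_measure)
  also have "\<dots> = (\<Sum>j\<in>{1..n}. prob (?E j))"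
    by (intro sum.cong refl) (simp add: Int_absorb2)
  finally show ?thesis .
qed

text \<open>One event tests both supports: \<open>j \<in> sym_diff R S\<close> is an error at
  \<open>j\<close> for \<open>S\<close>, and its failure is an error at \<open>j\<close> for
  \<open>sym_diff S {j}\<close>.\<close>

lemma swap_error_bound:
  fixes c \<mu> :: real
  assumes "adaptive_sensing M n m (signal \<mu> S) K Y A \<Gamma> W"
    and "adaptive_sensing M' n m (signal \<mu> (sym_diff S {j})) K Y' A' \<Gamma>' W'"
    and m: "0 \<le> m"
    and Shat: "Shat \<in> data_space n \<rightarrow>\<^sub>M count_space (Pow {1..n})"
  shows "exp (- c) * (1 / 2 + c / 2 - \<mu>\<^sup>2 * adaptive_sensing.energy M A \<Gamma> j / 4)
       \<le> measure M {\<omega> \<in> space M. j \<in> sym_diff (Shat (data Y A \<Gamma> \<omega>)) S}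
         + measure M' {\<omega> \<in> space M'. j \<in> sym_diff (Shat (data Y' A' \<Gamma>' \<omega>)) (sym_diff S {j})}"
proof -
  interpret P: adaptive_sensing M n m "signal \<mu> S" K Y A \<Gamma> W by fact
  interpret Q: adaptive_sensing M' n m "signal \<mu> (sym_diff S {j})" K Y' A' \<Gamma>' W' by fact
  let ?E = "Shat -` {R \<in> Pow {1..n}. j \<in> sym_diff R S} \<inter> space (data_space n)"
  have E: "?E \<in> sets (data_space n)"
    by (rule measurable_sets[OF Shat]) auto
  \<comment> \<open>The two signals differ at \<open>j\<close> only, by plus or minus
    \<open>\<mu>\<close>; squaring removes the sign.\<close>
  have sq: "(\<Gamma> i \<omega> * (signal \<mu> (sym_diff S {j}) (A i \<omega>) - signal \<mu> S (A i \<omega>)))\<^sup>2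
      = \<mu>\<^sup>2 * ((\<Gamma> i \<omega>)\<^sup>2 * indicator {j} (A i \<omega>))" for i \<omega>
    by (auto simp: signal_def indicator_def power_mult_distrib)
  have "(\<Sum>i<k. \<integral>\<omega>. (\<Gamma> i \<omega> * (signal \<mu> (sym_diff S {j}) (A i \<omega>) - signal \<mu> S (A i \<omega>)))\<^sup>2 \<partial>M)
      \<le> \<mu>\<^sup>2 * P.energy j" for k
    unfolding sq using mult_left_mono[OF P.partial_energy_le[OF m, of j k], of "\<mu>\<^sup>2"]
    by (simp add: sum_distrib_left)
  from data_test_bound[OF assms(1,2) m E this, of c]
  have "exp (- c) * (1 / 2 + c / 2 - \<mu>\<^sup>2 * P.energy j / 4)
      \<le> measure M {\<omega> \<in> space M. data Y A \<Gamma> \<omega> \<in> ?E} + measure M' {\<omega> \<in> space M'. data Y' A' \<Gamma>' \<omega> \<notin> ?E}" .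
  also have "{\<omega> \<in> space M. data Y A \<Gamma> \<omega> \<in> ?E} = {\<omega> \<in> space M. j \<in> sym_diff (Shat (data Y A \<Gamma> \<omega>)) S}"
    using measurable_space[OF P.data_measurable] measurable_space[OF Shat] by fastforce
  also have "{\<omega> \<in> space M'. data Y' A' \<Gamma>' \<omega> \<notin> ?E}
      = {\<omega> \<in> space M'. j \<in> sym_diff (Shat (data Y' A' \<Gamma>' \<omega>)) (sym_diff S {j})}"
    using measurable_space[OF Q.data_measurable] measurable_space[OF Shat] by fastforce
  finally show ?thesis .
qed

lemma finite_near_sparse_class: "finite (near_sparse_class n s)"
  unfolding near_sparse_class_def by (rule finite_subset[of _ "Pow {1..n}"]) auto

text \<open>The bounds for single entries are linear in the energies, so only their total matters,
  however the strategy distributes it. This \<open>c\<close> makes the energy terms cost at most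
  \<open>n * c / 2\<close>, exactly what the terms \<open>c / 2\<close> contribute, and leaves
  \<open>n / 2\<close>.\<close>

lemma sum_swap_error_bound:
  fixes c \<mu> m :: real and n s :: nat
  assumes sensing: "\<And>S. S \<in> near_sparse_class n s \<Longrightarrow>
           adaptive_sensing (M S) n m (signal \<mu> S) K (Y S) (A S) (\<Gamma> S) (W S)"
    and Shat: "Shat \<in> data_space n \<rightarrow>\<^sub>M count_space (Pow {1..n})"
    and m: "0 \<le> m" and n: "0 < n" and S: "S \<subseteq> {1..n}" "card S = s"
  defines "c \<equiv> m * \<mu>\<^sup>2 / (2 * real n)"
    and "err \<equiv> \<lambda>T j. measure (M T) {\<omega> \<in> space (M T). j \<in> sym_diff (Shat (data (Y T) (A T) (\<Gamma> T) \<omega>)) T}"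
  shows "real n / 2 * exp (- c) \<le> (\<Sum>j\<in>{1..n}. err S j + err (sym_diff S {j}) j)"
proof -
  have S_in: "S \<in> near_sparse_class n s" using S by (simp add: near_sparse_class_def)
  interpret P: adaptive_sensing "M S" n m "signal \<mu> S" K "Y S" "A S" "\<Gamma> S" "W S"
    by (rule sensing[OF S_in])
  have fS: "finite S" using S(1) finite_subset by blast
  \<comment> \<open>The swapped support has size \<open>s + 1\<close> or \<open>s - 1\<close>, so
    the experiment with that support is covered by \<open>sensing\<close>.\<close>
  have swap: "sym_diff S {j} \<in> near_sparse_class n s" if "j \<in> {1..n}" for j
  proof (cases "j \<in> S")
    case True
    then have "sym_diff S {j} = S - {j}" by auto
    then show ?thesis using True S fS by (auto simp: near_sparse_class_def)
  next
    case False
    then have "sym_diff S {j} = insert j S" by auto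
    then show ?thesis using False S fS that by (auto simp: near_sparse_class_def)
  qed
  have "\<mu>\<^sup>2 * (\<Sum>j\<in>{1..n}. P.energy j) \<le> \<mu>\<^sup>2 * m"
    by (intro mult_left_mono P.sum_energy_le m) simp
  also have "\<dots> = 2 * real n * c" using n by (simp add: c_def)
  finally have "real n / 2 \<le> (\<Sum>j\<in>{1..n}. 1 / 2 + c / 2 - \<mu>\<^sup>2 * P.energy j / 4)"
    by (simp add: sum_subtractf sum_distrib_left[symmetric] sum_divide_distrib[symmetric] field_simps)
  then have "real n / 2 * exp (- c) \<le> (\<Sum>j\<in>{1..n}. 1 / 2 + c / 2 - \<mu>\<^sup>2 * P.energy j / 4) * exp (- c)"
    by (intro mult_right_mono) auto
  also have "\<dots> = (\<Sum>j\<in>{1..n}. exp (- c) * (1 / 2 + c / 2 - \<mu>\<^sup>2 * P.energy j / 4))"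
    by (subst mult.commute) (rule sum_distrib_left)
  also have "\<dots> \<le> (\<Sum>j\<in>{1..n}. err S j + err (sym_diff S {j}) j)"
    unfolding err_def
    by (intro sum_mono swap_error_bound[OF sensing[OF S_in] sensing[OF swap] m Shat])
  finally show ?thesis .
qed

text \<open>A pair of support and entry can be recovered from the swapped support and the entry by
  swapping again. The sum can therefore be reindexed by the neighbouring supports, where the risk
  bound applies.\<close>

lemma sum_swap_le:
  fixes e :: "nat set \<Rightarrow> nat \<Rightarrow> real" and \<epsilon> :: real
  assumes nonneg: "\<And>T j. 0 \<le> e T j" and s: "1 \<le> s"
    and le: "\<And>T. T \<subseteq> {1..n} \<Longrightarrow> card T \<in> {s + 1, s - 1} \<Longrightarrow> (\<Sum>j\<in>{1..n}. e T j) \<le> \<epsilon>"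
  shows "(\<Sum>S | S \<subseteq> {1..n} \<and> card S = s. \<Sum>j\<in>{1..n}. e (sym_diff S {j}) j)
       \<le> (real (n choose (s + 1)) + real (n choose (s - 1))) * \<epsilon>"
proof -
  let ?C = "\<lambda>r. {S. S \<subseteq> {1..n} \<and> card S = r}"
  let ?f = "\<lambda>(S, j). (sym_diff S {j}, j)"
  have fin[simp]: "finite (?C r)" for r by (rule finite_subset[of _ "Pow {1..n}"]) auto
  have card_C: "card (?C r) = (n choose r)" for r using n_subsets[of "{1..n}" r] by simp
  have inj: "inj_on ?f (?C s \<times> {1..n})" by (auto simp: inj_on_def)
  have img: "?f ` (?C s \<times> {1..n}) \<subseteq> (?C (s + 1) \<union> ?C (s - 1)) \<times> {1..n}"
  proof (rule image_subsetI)
    fix p assume "p \<in> ?C s \<times> {1..n}"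
    then obtain S j where p: "p = (S, j)" and S: "S \<subseteq> {1..n}" "s = card S" and j: "j \<in> {1..n}"
      by auto
    have fS: "finite S" using S(1) finite_subset by blast
    have "card (sym_diff S {j}) = Suc (card S) \<or> card (sym_diff S {j}) = card S - Suc 0"
    proof (cases "j \<in> S")
      case True
      then have "sym_diff S {j} = S - {j}" by auto
      then show ?thesis using True fS by simp
    next
      case False
      then have "sym_diff S {j} = insert j S" by auto
      then show ?thesis using False fS by simp
    qed
    then show "?f p \<in> (?C (s + 1) \<union> ?C (s - 1)) \<times> {1..n}"
      using S j by (auto simp: p)
  qed
  have "(\<Sum>S\<in>?C s. \<Sum>j\<in>{1..n}. e (sym_diff S {j}) j) = (\<Sum>p\<in>?C s \<times> {1..n}. case_prod e (?f p))"
    by (simp add: sum.cartesian_product case_prod_beta')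
  also have "\<dots> = (\<Sum>p\<in>?f ` (?C s \<times> {1..n}). case_prod e p)"
    by (rule sum.reindex[OF inj, symmetric, unfolded o_def])
  \<comment> \<open>The image has only pairs with \<open>j\<close> inside the larger supports or
    outside the smaller ones; by nonnegativity the missing pairs may be added.\<close>
  also have "\<dots> \<le> (\<Sum>p\<in>(?C (s + 1) \<union> ?C (s - 1)) \<times> {1..n}. case_prod e p)"
    by (rule sum_mono2[OF _ img]) (auto simp: nonneg)
  also have "\<dots> = (\<Sum>T\<in>?C (s + 1) \<union> ?C (s - 1). \<Sum>j\<in>{1..n}. e T j)"
    by (simp add: sum.cartesian_product)
  also have "\<dots> \<le> (\<Sum>T\<in>?C (s + 1) \<union> ?C (s - 1). \<epsilon>)"
    by (rule sum_mono) (use le in auto)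
  also have "\<dots> = (real (n choose (s + 1)) + real (n choose (s - 1))) * \<epsilon>"
    by (subst sum.union_disjoint) (auto simp: card_C[unfolded One_nat_def] algebra_simps)
  finally show ?thesis .
qed

theorem theorem4p1:
  fixes n s :: nat
    and m \<mu> \<epsilon> :: real
    and K :: "nat \<Rightarrow> (nat \<Rightarrow> real \<times> nat \<times> real) \<Rightarrow> (nat \<times> real) measure"
    and M :: "nat set \<Rightarrow> 'w measure"
    and Y \<Gamma> W :: "nat set \<Rightarrow> nat \<Rightarrow> 'w \<Rightarrow> real"
    and A :: "nat set \<Rightarrow> nat \<Rightarrow> 'w \<Rightarrow> nat"
    and Shat :: "(nat \<Rightarrow> real \<times> nat \<times> real) \<Rightarrow> nat set"
  assumes "2 \<le> n" and "1 \<le> s" and "s \<le> n - 1" and "0 < m" and "0 < \<mu>"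
    and sensing: "\<And>S. S \<in> near_sparse_class n s \<Longrightarrow>
           adaptive_sensing (M S) n m (signal \<mu> S) K (Y S) (A S) (\<Gamma> S) (W S)"
    and estimator: "Shat \<in> data_space n \<rightarrow>\<^sub>M count_space (Pow {1..n})"
    and "0 < \<epsilon>" and "\<epsilon> < 1"
    and risk: "(MAX S\<in>near_sparse_class n s.
           \<integral>\<omega>. real (card (sym_diff (Shat (data (Y S) (A S) (\<Gamma> S) \<omega>)) S)) \<partial>M S) \<le> \<epsilon>"
  shows "\<forall>S\<in>near_sparse_class n s. S \<noteq> {} \<longrightarrow>
           x_min n (signal \<mu> S) \<ge>
             sqrt (2 * real n / m *
               (ln (real s) + ln ((real n - real s) / (real n + 1)) + ln (1 / (2 * \<epsilon>))))"
proof -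
  define c where "c = m * \<mu>\<^sup>2 / (2 * real n)"
  define err where "err = (\<lambda>T j. measure (M T) {\<omega> \<in> space (M T). j \<in> sym_diff (Shat (data (Y T) (A T) (\<Gamma> T) \<omega>)) T})"
  let ?C = "{S. S \<subseteq> {1..n} \<and> card S = s}"
  have card_C: "card ?C = (n choose s)" using n_subsets[of "{1..n}" s] by simp
  have err_le: "(\<Sum>j\<in>{1..n}. err T j) \<le> \<epsilon>" if T: "T \<in> near_sparse_class n s" for T
  proof -
    interpret adaptive_sensing "M T" n m "signal \<mu> T" K "Y T" "A T" "\<Gamma> T" "W T" by (rule sensing[OF T])
    have "T \<subseteq> {1..n}" using T by (simp add: near_sparse_class_def)
    from expected_error_eq_sum[OF estimator this]
    have "(\<Sum>j\<in>{1..n}. err T j) = (\<integral>\<omega>. real (card (sym_diff (Shat (data (Y T) (A T) (\<Gamma> T) \<omega>)) T)) \<partial>M T)"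
      by (simp add: err_def)
    also have "\<dots> \<le> (MAX S\<in>near_sparse_class n s.
           \<integral>\<omega>. real (card (sym_diff (Shat (data (Y S) (A S) (\<Gamma> S) \<omega>)) S)) \<partial>M S)"
      using T finite_near_sparse_class by (intro Max_ge) auto
    finally show ?thesis using risk by simp
  qed
  \<comment> \<open>Sum the lower bound over all supports of size \<open>s\<close>; summing makes
    each neighbouring support absorb the swapped errors of several of them.\<close>
  have "real (n choose s) * (real n / 2 * exp (- c)) = (\<Sum>S\<in>?C. real n / 2 * exp (- c))"
    by (simp only: sum_constant card_C)
  also have "\<dots> \<le> (\<Sum>S\<in>?C. \<Sum>j\<in>{1..n}. err S j + err (sym_diff S {j}) j)"
    unfolding c_def err_def
    by (intro sum_mono sum_swap_error_bound[OF sensing estimator]) (use assms in auto)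
  also have "\<dots> = (\<Sum>S\<in>?C. \<Sum>j\<in>{1..n}. err S j) + (\<Sum>S\<in>?C. \<Sum>j\<in>{1..n}. err (sym_diff S {j}) j)"
    by (simp add: sum.distrib)
  \<comment> \<open>The unswapped errors are bounded by the risk at size \<open>s\<close>, the
    swapped ones by the risk at sizes \<open>s + 1\<close> and \<open>s - 1\<close>.\<close>
  also have "\<dots> \<le> (\<Sum>S\<in>?C. \<epsilon>) + (real (n choose (s + 1)) + real (n choose (s - 1))) * \<epsilon>"
    by (intro add_mono sum_mono sum_swap_le err_le)
      (use assms in \<open>auto simp: err_def near_sparse_class_def\<close>)
  also have "\<dots> = (real (n choose s) + real (n choose (s + 1)) + real (n choose (s - 1))) * \<epsilon>"
    by (simp only: sum_constant card_C distrib_right add.assoc)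
  finally have bound: "exp (- c) * real s * (real n - real s) \<le> 2 * \<epsilon> * (real n + 1)"
    using assms by (intro swap_sum_sparse_bound) auto
  have pos: "0 < real s" "0 < real n - real s" using assms by auto
  have "real s * (real n - real s) = exp c * (exp (- c) * real s * (real n - real s))"
    by (simp add: exp_minus)
  also have "\<dots> \<le> exp c * (2 * \<epsilon> * (real n + 1))"
    using bound by (intro mult_left_mono) auto
  finally have "real s * (real n - real s) / (2 * \<epsilon> * (real n + 1)) \<le> exp c"
    using \<open>0 < \<epsilon>\<close> by (subst pos_divide_le_eq) auto
  then have "real s * ((real n - real s) / (real n + 1)) * (1 / (2 * \<epsilon>)) \<le> exp c"
    by (simp add: mult.commute)
  then have "ln (real s * ((real n - real s) / (real n + 1)) * (1 / (2 * \<epsilon>))) \<le> ln (exp c)"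
    using pos assms by (subst ln_le_cancel_iff) auto
  \<comment> \<open>Each factor is positive, which is what splitting the logarithm of the product
    requires.\<close>
  moreover have "0 < (real n - real s) / (real n + 1)" "0 < 1 / (2 * \<epsilon>)"
    using pos \<open>0 < \<epsilon>\<close> by auto
  ultimately have "ln (real s) + ln ((real n - real s) / (real n + 1)) + ln (1 / (2 * \<epsilon>)) \<le> c"
    using pos(1) by (simp only: ln_mult_pos mult_pos_pos ln_exp)
  then have "2 * real n / m * (ln (real s) + ln ((real n - real s) / (real n + 1)) + ln (1 / (2 * \<epsilon>)))
      \<le> 2 * real n / m * c"
    using assms by (intro mult_left_mono) auto
  also have "\<dots> = \<mu>\<^sup>2" using assms by (simp add: c_def)
  \<comment> \<open>A negative radicand is included: \<open>sqrt\<close> is then negative and the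
    bound is trivial, since \<open>\<mu>\<close> is positive.\<close>
  finally have "sqrt (2 * real n / m * (ln (real s) + ln ((real n - real s) / (real n + 1)) + ln (1 / (2 * \<epsilon>)))) \<le> \<mu>"
    using assms by (intro real_le_lsqrt) auto
  then show ?thesis
    using assms by (auto simp: x_min_signal near_sparse_class_def)
qed

end
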